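(* Let $f(z)=\sum_{j=0}^{\infty}a_jz^j$ be an absolutely summable power series expansion with real coefficients $a_j$, let $\mathcal{X}\subseteq\mathbb{C}^n$ be such that $\sum_{j}|a_j||y^*x|^j<\infty$ for all $x,y\in\mathcal{X}$, and consider the reproducing kernel $K:\mathcal{X}\times\mathcal{X}\to\mathbb{C}$, $K(x,y)=f(y^*x)$. Denote by $\mathcal{K}$ the Krein space corresponding to the reproducing kernel $K$. Let $\{c_j\}_{j=0}^{\infty}$ be a sequence of numbers in $\{-1,1\}$. Then the Krein space induced by the kernel $$(x,y)\mapsto\sum_{j=0}^{\infty}c_ja_j(y^*x)^j$$ contains the same functions as the original Krein space $\mathcal{K}$.
   Context: A kernel function on $\mathcal{X}$ is a function $k:\mathcal{X}\times\mathcal{X}\to\mathbb{C}$ such that for all finite families $x_1,\dots,x_N\in\mathcal{X}$ the matrix $(k(x_i,x_j))$ is nonnegative semidefinite; $\mathcal{H}(k)$ denotes the reproducing kernel Hilbert space on $\mathcal{X}$ with reproducing kernel $k$. A Krein space is a complex vector space $\mathcal{K}$ with a Hermitian form $[\cdot,\cdot]$ admitting a decomposition $\mathcal{K}=\mathcal{K}_+\oplus\mathcal{K}_-$, with $\mathcal{K}_+\cap\mathcal{K}_-=\{0\}$ and $[k_+,k_-]=0$ for $k_\pm\in\mathcal{K}_\pm$, such that $(\mathcal{K}_+,[\cdot,\cdot])$ and $(\mathcal{K}_-,-[\cdot,\cdot])$ are Hilbert spaces. A reproducing kernel Krein space on $\mathcal{X}$ is a Krein space of functions on $\mathcal{X}$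 with a function $K(x,y)=k_y(x)$ such that $k_z\in\mathcal{K}$ and $f(z)=[f,k_z]$ for all $z\in\mathcal{X}$, $f\in\mathcal{K}$; $K$ is its reproducing kernel. For a power series kernel $K(x,y)=\sum_j a_j(y^*x)^j$ with real $a_j$, set $K_+=\sum_{a_j>0}a_j(y^*x)^j$ and $K_-=\sum_{a_j<0}a_j(y^*x)^j$, so that $K_+$ and $-K_-$ are kernel functions. The Krein space induced by $K$ consists of the functions of the form $f_++f_-$ with $f_+\in\mathcal{H}(K_+)$ and $f_-\in\mathcal{H}(-K_-)$; its positive part is $\mathcal{H}(K_+)$ and its negative part is $\mathcal{H}(-K_-)$ with the negative of its inner product. *)

theory Defs
  imports "HOL-Analysis.Analysis" "HOL-Library.Function_Algebras"
begin

text \<open>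
  Functions on a set \<open>X\<close> are represented by total functions that vanish outside \<open>X\<close>, so that
  equality of functions on \<open>X\<close> is equality of terms; addition, subtraction and zero are the
  pointwise ones. A \<open>form_space\<close> is a set of such functions together with a form, which is only
  meaningful for arguments in that set.
\<close>

record 'a form_space =
  funs :: "('a \<Rightarrow> complex) set"
  form :: "('a \<Rightarrow> complex) \<Rightarrow> ('a \<Rightarrow> complex) \<Rightarrow> complex"

definition neg_form :: "'a form_space \<Rightarrow> 'a form_space" where
  "neg_form V = \<lparr>funs = funs V, form = (\<lambda>f g. - form V f g)\<rparr>"

definition function_space_on :: "'a set \<Rightarrow> ('a \<Rightarrow> complex) set \<Rightarrow> bool" where
  "function_space_on X V \<longleftrightarrow>
     (\<forall>f\<in>V. \<forall>x. x \<notin> X \<longrightarrow> f x = 0) \<and>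
     0 \<in> V \<and> (\<forall>f\<in>V. \<forall>g\<in>V. f + g \<in> V) \<and> (\<forall>c. \<forall>f\<in>V. (\<lambda>x. c * f x) \<in> V)"

definition hermitian_form_on ::
    "('a \<Rightarrow> complex) set \<Rightarrow> (('a \<Rightarrow> complex) \<Rightarrow> ('a \<Rightarrow> complex) \<Rightarrow> complex) \<Rightarrow> bool" where
  "hermitian_form_on V b \<longleftrightarrow>
     (\<forall>f\<in>V. \<forall>g\<in>V. \<forall>h\<in>V. b (f + g) h = b f h + b g h) \<and>
     (\<forall>c. \<forall>f\<in>V. \<forall>g\<in>V. b (\<lambda>x. c * f x) g = c * b f g) \<and>
     (\<forall>f\<in>V. \<forall>g\<in>V. b g f = cnj (b f g))"

definition form_norm :: "'a form_space \<Rightarrow> ('a \<Rightarrow> complex) \<Rightarrow> real" where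
  "form_norm V f = sqrt (Re (form V f f))"

definition hilbert_space_on :: "'a set \<Rightarrow> 'a form_space \<Rightarrow> bool" where
  "hilbert_space_on X V \<longleftrightarrow>
     function_space_on X (funs V) \<and>
     hermitian_form_on (funs V) (form V) \<and>
     (\<forall>f\<in>funs V. f \<noteq> 0 \<longrightarrow> Re (form V f f) > 0) \<and>
     (\<forall>s. (\<forall>i::nat. s i \<in> funs V) \<and>
          (\<forall>e>0. \<exists>N. \<forall>m\<ge>N. \<forall>n\<ge>N. form_norm V (s m - s n) < e) \<longrightarrow>
          (\<exists>l\<in>funs V. (\<lambda>i. form_norm V (s i - l)) \<longlonglongrightarrow> 0))"

definition krein_space_on :: "'a set \<Rightarrow> 'a form_space \<Rightarrow> bool" where
  "krein_space_on X V \<longleftrightarrow>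
     function_space_on X (funs V) \<and>
     hermitian_form_on (funs V) (form V) \<and>
     (\<exists>P N. funs V = {f + g | f g. f \<in> P \<and> g \<in> N} \<and> P \<inter> N = {0} \<and>
            (\<forall>f\<in>P. \<forall>g\<in>N. form V f g = 0) \<and>
            hilbert_space_on X \<lparr>funs = P, form = form V\<rparr> \<and>
            hilbert_space_on X (neg_form \<lparr>funs = N, form = form V\<rparr>))"

definition kernel_section :: "'a set \<Rightarrow> ('a \<Rightarrow> 'a \<Rightarrow> complex) \<Rightarrow> 'a \<Rightarrow> 'a \<Rightarrow> complex" where
  "kernel_section X k y = (\<lambda>x. if x \<in> X then k x y else 0)"

definition reproducing_on :: "'a set \<Rightarrow> ('a \<Rightarrow> 'a \<Rightarrow> complex) \<Rightarrow> 'a form_space \<Rightarrow> bool" where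
  "reproducing_on X k V \<longleftrightarrow>
     (\<forall>y\<in>X. kernel_section X k y \<in> funs V \<and>
            (\<forall>f\<in>funs V. f y = form V f (kernel_section X k y)))"

text \<open>
  The last conjunct fixes the irrelevant values of the form; without it the description below
  would not determine the record uniquely.
\<close>

definition is_rkhs :: "'a set \<Rightarrow> ('a \<Rightarrow> 'a \<Rightarrow> complex) \<Rightarrow> 'a form_space \<Rightarrow> bool" where
  "is_rkhs X k V \<longleftrightarrow>
     hilbert_space_on X V \<and> reproducing_on X k V \<and>
     (\<forall>f g. f \<notin> funs V \<or> g \<notin> funs V \<longrightarrow> form V f g = 0)"

definition rkhs :: "'a set \<Rightarrow> ('a \<Rightarrow> 'a \<Rightarrow> complex) \<Rightarrow> 'a form_space" where
  "rkhs X k = (THE V. is_rkhs X k V)"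

text \<open>The product \<open>y\<^sup>* x\<close> of column vectors, antilinear in the first argument.\<close>

definition star_prod :: "complex ^ 'n \<Rightarrow> complex ^ 'n \<Rightarrow> complex" where
  "star_prod y x = (\<Sum>i\<in>UNIV. cnj (y $ i) * x $ i)"

definition series_kernel :: "(nat \<Rightarrow> real) \<Rightarrow> complex ^ 'n \<Rightarrow> complex ^ 'n \<Rightarrow> complex" where
  "series_kernel a x y = (\<Sum>j. complex_of_real (a j) * star_prod y x ^ j)"

definition series_kernel_pos :: "(nat \<Rightarrow> real) \<Rightarrow> complex ^ 'n \<Rightarrow> complex ^ 'n \<Rightarrow> complex" where
  "series_kernel_pos a = series_kernel (\<lambda>j. if a j > 0 then a j else 0)"

definition series_kernel_neg :: "(nat \<Rightarrow> real) \<Rightarrow> complex ^ 'n \<Rightarrow> complex ^ 'n \<Rightarrow> complex" where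
  "series_kernel_neg a = series_kernel (\<lambda>j. if a j < 0 then a j else 0)"

record 'a krein_space = "'a form_space" +
  positive_part :: "'a form_space"
  negative_part :: "'a form_space"

text \<open>
  The space induced by a power series kernel depends on the coefficients and not only on the
  kernel as a function on \<open>X\<close> (on a one-point \<open>X\<close>, say, many series give the same kernel), so it
  is a function of the coefficients. The functions and the two parts are always meaningful; the
  form is well defined if the two parts intersect in 0, which is the case in which the
  construction yields a Krein space (lemma \<open>induced_krein_space_krein\<close> below).
\<close>

definition induced_krein_space ::
    "(complex ^ 'n) set \<Rightarrow> (nat \<Rightarrow> real) \<Rightarrow> (complex ^ 'n) krein_space" where
  "induced_krein_space X a =
    (let P = rkhs X (series_kernel_pos a);
         N = neg_form (rkhs X (\<lambda>x y. - series_kernel_neg a x y))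
     in \<lparr>funs = {f + g | f g. f \<in> funs P \<and> g \<in> funs N},
         form = (\<lambda>f g. THE c. \<exists>f1\<in>funs P. \<exists>f2\<in>funs N. \<exists>g1\<in>funs P. \<exists>g2\<in>funs N.
                   f = f1 + f2 \<and> g = g1 + g2 \<and> c = form P f1 g1 + form N f2 g2),
         positive_part = P, negative_part = N\<rparr>)"

lemma function_space_on_diff:
  assumes "function_space_on X V" "f \<in> V" "g \<in> V"
  shows "f - g \<in> V"
proof -
  have "(\<lambda>x. (-1) * g x) \<in> V"
    using assms unfolding function_space_on_def by blast
  then have "f + (\<lambda>x. (-1) * g x) \<in> V"
    using assms unfolding function_space_on_def by blast
  moreover have "f + (\<lambda>x. (-1) * g x) = f - g"
    by (auto simp: fun_eq_iff)
  ultimately show ?thesis by simp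
qed

lemma hermitian_form_on_zero:
  assumes "function_space_on X V" "hermitian_form_on V b" "f \<in> V"
  shows "b 0 f = 0" "b f 0 = 0"
proof -
  have z: "0 \<in> V" using assms(1) by (auto simp: function_space_on_def)
  have "b (0 + 0) f = b 0 f + b 0 f"
    using assms(2,3) z unfolding hermitian_form_on_def by blast
  then show "b 0 f = 0" by simp
  moreover have "b f 0 = cnj (b 0 f)"
    using assms(2,3) z unfolding hermitian_form_on_def by blast
  ultimately show "b f 0 = 0" by simp
qed

lemma hermitian_form_on_add_right:
  assumes "function_space_on X V" "hermitian_form_on V b" "f \<in> V" "g \<in> V" "h \<in> V"
  shows "b f (g + h) = b f g + b f h"
proof -
  have gh: "g + h \<in> V" using assms by (auto simp: function_space_on_def)
  have "b f (g + h) = cnj (b (g + h) f)"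
    using assms gh unfolding hermitian_form_on_def by blast
  also have "\<dots> = cnj (b g f + b h f)"
    using assms unfolding hermitian_form_on_def by metis
  also have "\<dots> = cnj (b g f) + cnj (b h f)" by simp
  also have "\<dots> = b f g + b f h"
    using assms unfolding hermitian_form_on_def by metis
  finally show ?thesis .
qed

lemma hilbert_space_on_cong:
  assumes "hilbert_space_on X V" "funs W = funs V"
    and eq: "\<And>f g. f \<in> funs V \<Longrightarrow> g \<in> funs V \<Longrightarrow> form W f g = form V f g"
  shows "hilbert_space_on X W"
proof -
  have fs: "function_space_on X (funs V)"
    using assms(1) by (simp add: hilbert_space_on_def)
  have herm: "hermitian_form_on (funs V) (form W)"
    unfolding hermitian_form_on_def
  proof (intro conjI ballI allI)
    have b: "hermitian_form_on (funs V) (form V)"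
      using assms(1) by (simp add: hilbert_space_on_def)
    fix c :: complex and f g h assume *: "f \<in> funs V" "g \<in> funs V"
    then have m: "f + g \<in> funs V" "(\<lambda>x. c * f x) \<in> funs V"
      using fs unfolding function_space_on_def by blast+
    show "form W (\<lambda>x. c * f x) g = c * form W f g"
      unfolding eq[OF m(2) *(2)] eq[OF *] using b * unfolding hermitian_form_on_def by blast
    show "form W g f = cnj (form W f g)"
      unfolding eq[OF *(2,1)] eq[OF *] using b * unfolding hermitian_form_on_def by blast
    assume h: "h \<in> funs V"
    show "form W (f + g) h = form W f h + form W g h"
      unfolding eq[OF m(1) h] eq[OF *(1) h] eq[OF *(2) h]
      using b * h unfolding hermitian_form_on_def by blast
  qed
  have nrm: "form_norm W f = form_norm V f" if "f \<in> funs V" for f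
    using that eq by (simp add: form_norm_def)
  have compl: "\<exists>l\<in>funs V. (\<lambda>i. form_norm W (s i - l)) \<longlonglongrightarrow> 0"
    if s: "\<And>i::nat. s i \<in> funs V"
      and C: "\<forall>e>0. \<exists>N. \<forall>m\<ge>N. \<forall>n\<ge>N. form_norm W (s m - s n) < e" for s
  proof -
    have "form_norm W (s m - s n) = form_norm V (s m - s n)" for m n
      using nrm function_space_on_diff[OF fs s s] by blast
    then have "\<forall>e>0. \<exists>N. \<forall>m\<ge>N. \<forall>n\<ge>N. form_norm V (s m - s n) < e"
      using C by simp
    then obtain l where l: "l \<in> funs V" "(\<lambda>i. form_norm V (s i - l)) \<longlonglongrightarrow> 0"
      using assms(1) s unfolding hilbert_space_on_def by blast
    have "(\<lambda>i. form_norm W (s i - l)) = (\<lambda>i. form_norm V (s i - l))"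
      by (rule ext, rule nrm, rule function_space_on_diff[OF fs s l(1)])
    then show ?thesis using l by metis
  qed
  show ?thesis
    unfolding hilbert_space_on_def assms(2)
  proof (intro conjI allI impI ballI)
    show "0 < Re (form W f f)" if "f \<in> funs V" "f \<noteq> 0" for f
      unfolding eq[OF that(1) that(1)] using assms(1) that by (simp add: hilbert_space_on_def)
    show "\<exists>l\<in>funs V. (\<lambda>i. form_norm W (s i - l)) \<longlonglongrightarrow> 0"
      if "(\<forall>i. s i \<in> funs V) \<and>
          (\<forall>e>0. \<exists>N. \<forall>m\<ge>N. \<forall>n\<ge>N. form_norm W (s m - s n) < e)" for s
      using compl[of s] that by blast
  qed (fact fs herm)+
qed

text \<open>
  In the nondegenerate case the induced space is a reproducing kernel Krein space with the
  expected kernel.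
\<close>

lemma induced_krein_space_krein:
  fixes X :: "(complex ^ 'n) set"
  assumes summ: "\<And>x y. x \<in> X \<Longrightarrow> y \<in> X \<Longrightarrow> summable (\<lambda>j. \<bar>a j\<bar> * norm (star_prod y x) ^ j)"
    and hp: "is_rkhs X (series_kernel_pos a) (rkhs X (series_kernel_pos a))"
    and hn: "is_rkhs X (\<lambda>x y. - series_kernel_neg a x y) (rkhs X (\<lambda>x y. - series_kernel_neg a x y))"
    and triv: "funs (positive_part (induced_krein_space X a)) \<inter>
               funs (negative_part (induced_krein_space X a)) = {0}"
  defines "\<K> \<equiv> form_space.truncate (induced_krein_space X a)"
  shows "krein_space_on X \<K>" "reproducing_on X (series_kernel a) \<K>"
proof -
  define P where "P = rkhs X (series_kernel_pos a)"
  define M where "M = rkhs X (\<lambda>x y. - series_kernel_neg a x y)"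
  define N where "N = neg_form M"
  have hP: "hilbert_space_on X P" and rP: "reproducing_on X (series_kernel_pos a) P"
    using hp by (auto simp: is_rkhs_def P_def)
  have hM: "hilbert_space_on X M" and rM: "reproducing_on X (\<lambda>x y. - series_kernel_neg a x y) M"
    using hn by (auto simp: is_rkhs_def M_def)
  have fN: "funs N = funs M" "form N = (\<lambda>f g. - form M f g)"
    by (auto simp: N_def neg_form_def)
  have sP: "function_space_on X (funs P)" and bP: "hermitian_form_on (funs P) (form P)"
    using hP by (auto simp: hilbert_space_on_def)
  have sN: "function_space_on X (funs N)" and bM: "hermitian_form_on (funs N) (form M)"
    using hM by (auto simp: hilbert_space_on_def fN)
  have bN: "hermitian_form_on (funs N) (form N)"
    unfolding hermitian_form_on_def fN
  proof (intro conjI ballI allI)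
    fix c :: complex and f g h assume *: "f \<in> funs M" "g \<in> funs M"
    have "form M (\<lambda>x. c * f x) g = c * form M f g" "form M g f = cnj (form M f g)"
      using bM * unfolding hermitian_form_on_def fN by blast+
    then show "- form M (\<lambda>x. c * f x) g = c * - form M f g" "- form M g f = cnj (- form M f g)"
      by simp_all
    assume "h \<in> funs M"
    then have "form M (f + g) h = form M f h + form M g h"
      using bM * unfolding hermitian_form_on_def fN by blast
    then show "- form M (f + g) h = - form M f h + - form M g h" by simp
  qed
  have triv': "funs P \<inter> funs N = {0}"
    using triv by (simp add: induced_krein_space_def Let_def P_def N_def M_def)
  have funsK: "funs \<K> = {f + g | f g. f \<in> funs P \<and> g \<in> funs N}"
    by (simp add: \<K>_def form_space.truncate_def induced_krein_space_def Let_def P_def N_def M_def)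
  have uniq: "f1 = g1 \<and> f2 = g2"
    if "f1 \<in> funs P" "g1 \<in> funs P" "f2 \<in> funs N" "g2 \<in> funs N" "f1 + f2 = g1 + g2"
    for f1 f2 g1 g2
  proof -
    have eq: "f1 - g1 = g2 - f2"
      using that(5) by (auto simp: fun_eq_iff algebra_simps)
    have "f1 - g1 \<in> funs P" "g2 - f2 \<in> funs N"
      using that function_space_on_diff sP sN by blast+
    then have "f1 - g1 \<in> funs P \<inter> funs N" using eq by (metis IntI)
    then have "f1 - g1 = 0" using triv' by blast
    then show ?thesis using eq by (metis right_minus_eq)
  qed
  have formK: "form \<K> (f1 + f2) (g1 + g2) = form P f1 g1 + form N f2 g2"
    if "f1 \<in> funs P" "g1 \<in> funs P" "f2 \<in> funs N" "g2 \<in> funs N" for f1 f2 g1 g2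
  proof -
    have "form \<K> (f1 + f2) (g1 + g2) =
      (THE c. \<exists>f1'\<in>funs P. \<exists>f2'\<in>funs N. \<exists>g1'\<in>funs P. \<exists>g2'\<in>funs N.
        f1 + f2 = f1' + f2' \<and> g1 + g2 = g1' + g2' \<and> c = form P f1' g1' + form N f2' g2')"
      by (simp add: \<K>_def form_space.truncate_def induced_krein_space_def Let_def P_def N_def M_def)
    also have "\<dots> = form P f1 g1 + form N f2 g2"
    proof (rule the_equality)
      show "\<exists>f1'\<in>funs P. \<exists>f2'\<in>funs N. \<exists>g1'\<in>funs P. \<exists>g2'\<in>funs N.
        f1 + f2 = f1' + f2' \<and> g1 + g2 = g1' + g2' \<and>
        form P f1 g1 + form N f2 g2 = form P f1' g1' + form N f2' g2'"
        using that by blast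
    next
      fix c
      assume "\<exists>f1'\<in>funs P. \<exists>f2'\<in>funs N. \<exists>g1'\<in>funs P. \<exists>g2'\<in>funs N.
        f1 + f2 = f1' + f2' \<and> g1 + g2 = g1' + g2' \<and> c = form P f1' g1' + form N f2' g2'"
      then obtain f1' f2' g1' g2' where *: "f1' \<in> funs P" "f2' \<in> funs N" "g1' \<in> funs P" "g2' \<in> funs N"
        "f1 + f2 = f1' + f2'" "g1 + g2 = g1' + g2'" "c = form P f1' g1' + form N f2' g2'"
        by blast
      then show "c = form P f1 g1 + form N f2 g2"
        using uniq[of f1 f1' f2 f2'] uniq[of g1 g1' g2 g2'] that by simp
    qed
    finally show ?thesis .
  qed
  have zP: "0 \<in> funs P" and zN: "0 \<in> funs N"
    using sP sN by (auto simp: function_space_on_def)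
  have formPP: "form \<K> f g = form P f g" if "f \<in> funs P" "g \<in> funs P" for f g
    using formK[OF that zN zN] hermitian_form_on_zero[OF sN bN zN] by simp
  have formNN: "form \<K> f g = form N f g" if "f \<in> funs N" "g \<in> funs N" for f g
    using formK[OF zP zP that] hermitian_form_on_zero[OF sP bP zP] by simp
  have formPN: "form \<K> f g = 0" if "f \<in> funs P" "g \<in> funs N" for f g
    using formK[of f 0 0 g] that zP zN hermitian_form_on_zero[OF sP bP] hermitian_form_on_zero[OF sN bN]
    by simp
  have space: "function_space_on X (funs \<K>)"
    unfolding function_space_on_def
  proof (intro conjI ballI allI impI)
    fix f x assume "f \<in> funs \<K>" "x \<notin> X"
    then show "f x = 0"
      using sP sN unfolding funsK function_space_on_def by auto
  next
    have "(0::_ \<Rightarrow> complex) + 0 \<in> funs \<K>" using zP zN unfolding funsK by blast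
    then show "0 \<in> funs \<K>" by simp
  next
    fix f g assume "f \<in> funs \<K>" "g \<in> funs \<K>"
    then obtain f1 f2 g1 g2 where *: "f1 \<in> funs P" "f2 \<in> funs N" "g1 \<in> funs P" "g2 \<in> funs N"
      "f = f1 + f2" "g = g1 + g2"
      unfolding funsK by blast
    then have "f1 + g1 \<in> funs P" "f2 + g2 \<in> funs N" "f + g = (f1 + g1) + (f2 + g2)"
      using sP sN by (auto simp: function_space_on_def algebra_simps)
    then show "f + g \<in> funs \<K>" unfolding funsK by blast
  next
    fix c f assume "f \<in> funs \<K>"
    then obtain f1 f2 where *: "f1 \<in> funs P" "f2 \<in> funs N" "f = f1 + f2"
      unfolding funsK by blast
    then have "(\<lambda>x. c * f1 x) \<in> funs P" "(\<lambda>x. c * f2 x) \<in> funs N"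
      "(\<lambda>x. c * f x) = (\<lambda>x. c * f1 x) + (\<lambda>x. c * f2 x)"
      using sP sN by (auto simp: function_space_on_def algebra_simps fun_eq_iff)
    then show "(\<lambda>x. c * f x) \<in> funs \<K>" unfolding funsK by blast
  qed
  have herm: "hermitian_form_on (funs \<K>) (form \<K>)"
    unfolding hermitian_form_on_def
  proof (intro conjI ballI allI)
    fix f g h assume "f \<in> funs \<K>" "g \<in> funs \<K>" "h \<in> funs \<K>"
    then obtain f1 f2 g1 g2 h1 h2 where *: "f1 \<in> funs P" "f2 \<in> funs N" "g1 \<in> funs P" "g2 \<in> funs N"
      "h1 \<in> funs P" "h2 \<in> funs N" "f = f1 + f2" "g = g1 + g2" "h = h1 + h2"
      unfolding funsK by blast
    then have m: "f1 + g1 \<in> funs P" "f2 + g2 \<in> funs N" and e: "f + g = (f1 + g1) + (f2 + g2)"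
      using sP sN by (auto simp: function_space_on_def algebra_simps)
    have "form \<K> (f + g) h = form P (f1 + g1) h1 + form N (f2 + g2) h2"
      unfolding e *(9) by (rule formK[OF m(1) *(5) m(2) *(6)])
    also have "\<dots> = (form P f1 h1 + form P g1 h1) + (form N f2 h2 + form N g2 h2)"
      using bP bN * unfolding hermitian_form_on_def by metis
    also have "\<dots> = form \<K> f h + form \<K> g h"
      using formK * by simp
    finally show "form \<K> (f + g) h = form \<K> f h + form \<K> g h" .
  next
    fix c f g assume "f \<in> funs \<K>" "g \<in> funs \<K>"
    then obtain f1 f2 g1 g2 where *: "f1 \<in> funs P" "f2 \<in> funs N" "g1 \<in> funs P" "g2 \<in> funs N"
      "f = f1 + f2" "g = g1 + g2"
      unfolding funsK by blast
    then have m: "(\<lambda>x. c * f1 x) \<in> funs P" "(\<lambda>x. c * f2 x) \<in> funs N"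
      and e: "(\<lambda>x. c * f x) = (\<lambda>x. c * f1 x) + (\<lambda>x. c * f2 x)"
      using sP sN by (auto simp: function_space_on_def algebra_simps fun_eq_iff)
    have "form \<K> (\<lambda>x. c * f x) g = form P (\<lambda>x. c * f1 x) g1 + form N (\<lambda>x. c * f2 x) g2"
      unfolding e *(6) by (rule formK[OF m(1) *(3) m(2) *(4)])
    also have "\<dots> = c * form P f1 g1 + c * form N f2 g2"
      using bP bN * unfolding hermitian_form_on_def by metis
    also have "\<dots> = c * form \<K> f g"
      using formK * by (simp add: algebra_simps)
    finally show "form \<K> (\<lambda>x. c * f x) g = c * form \<K> f g" .
  next
    fix f g assume "f \<in> funs \<K>" "g \<in> funs \<K>"
    then obtain f1 f2 g1 g2 where *: "f1 \<in> funs P" "f2 \<in> funs N" "g1 \<in> funs P" "g2 \<in> funs N"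
      "f = f1 + f2" "g = g1 + g2"
      unfolding funsK by blast
    have "form P g1 f1 = cnj (form P f1 g1)" "form N g2 f2 = cnj (form N f2 g2)"
      using bP bN * unfolding hermitian_form_on_def by blast+
    then show "form \<K> g f = cnj (form \<K> f g)"
      unfolding *(5,6) formK[OF *(1,3,2,4)] formK[OF *(3,1,4,2)] complex_cnj_add by metis
  qed
  have hilP: "hilbert_space_on X \<lparr>funs = funs P, form = form \<K>\<rparr>"
    by (rule hilbert_space_on_cong[OF hP]) (use formPP in auto)
  have hilN: "hilbert_space_on X (neg_form \<lparr>funs = funs N, form = form \<K>\<rparr>)"
    by (rule hilbert_space_on_cong[OF hM]) (use formNN in \<open>auto simp: neg_form_def fN\<close>)
  have orth: "\<forall>f\<in>funs P. \<forall>g\<in>funs N. form \<K> f g = 0"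
    by (intro ballI formPN)
  show "krein_space_on X \<K>"
    unfolding krein_space_on_def
    by (rule conjI[OF space conjI[OF herm]], rule exI[of _ "funs P"], rule exI[of _ "funs N"])
      (rule conjI[OF funsK conjI[OF triv' conjI[OF orth conjI[OF hilP hilN]]]])
  show "reproducing_on X (series_kernel a) \<K>"
    unfolding reproducing_on_def
  proof (intro ballI conjI)
    fix y assume y: "y \<in> X"
    define p where "p = kernel_section X (series_kernel_pos a) y"
    define m where "m = kernel_section X (\<lambda>x y. - series_kernel_neg a x y) y"
    have p: "p \<in> funs P" "\<And>f. f \<in> funs P \<Longrightarrow> f y = form P f p"
      using rP y by (auto simp: reproducing_on_def p_def)
    have m: "m \<in> funs N" "\<And>f. f \<in> funs N \<Longrightarrow> f y = form M f m"
      using rM y by (auto simp: reproducing_on_def m_def fN)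
    have z: "(\<lambda>x. (-1) * m x) \<in> funs N"
      using sN m(1) unfolding function_space_on_def by blast
    then have mN: "- m \<in> funs N"
      by (simp add: fun_Compl_def)
    have mf: "form N f (- m) = form M f m" if "f \<in> funs N" for f
    proof -
      have "form N f (m + (- m)) = form N f m + form N f (- m)"
        by (rule hermitian_form_on_add_right[OF sN bN that m(1) mN])
      moreover have "form N f 0 = 0"
        by (rule hermitian_form_on_zero[OF sN bN that])
      moreover have "m + (- m) = 0" by (simp add: fun_eq_iff)
      ultimately have "form N f m + form N f (- m) = 0" by metis
      then have "form N f (- m) = - form N f m" by (simp add: eq_neg_iff_add_eq_0 add.commute)
      then show ?thesis by (simp add: fN)
    qed
    have sec: "kernel_section X (series_kernel a) y = p + (- m)"
    proof
      fix x
      show "kernel_section X (series_kernel a) y x = (p + (- m)) x"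
      proof (cases "x \<in> X")
        case True
        let ?z = "star_prod y x"
        have s: "summable (\<lambda>j. \<bar>a j\<bar> * norm ?z ^ j)" using summ True y by blast
        have s1: "summable (\<lambda>j. complex_of_real (if a j > 0 then a j else 0) * ?z ^ j)"
          and s2: "summable (\<lambda>j. complex_of_real (if a j < 0 then a j else 0) * ?z ^ j)"
          by (rule summable_comparison_test'[OF s, of 0];
              auto simp: norm_mult norm_power mult_nonpos_nonneg)+
        have "series_kernel a x y = series_kernel_pos a x y + series_kernel_neg a x y"
          unfolding series_kernel_pos_def series_kernel_neg_def series_kernel_def suminf_add[OF s1 s2]
          by (rule arg_cong[where f = suminf]) (auto simp: fun_eq_iff)
        then show ?thesis using True by (simp add: kernel_section_def p_def m_def)
      qed (simp add: kernel_section_def p_def m_def)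
    qed
    show "kernel_section X (series_kernel a) y \<in> funs \<K>"
      unfolding sec funsK using p(1) mN by blast
    fix f assume "f \<in> funs \<K>"
    then obtain f1 f2 where *: "f1 \<in> funs P" "f2 \<in> funs N" "f = f1 + f2"
      unfolding funsK by blast
    have "f y = form P f1 p + form N f2 (- m)"
      unfolding mf[OF *(2)] p(2)[OF *(1), symmetric] m(2)[OF *(2), symmetric] *(3) by simp
    also have "\<dots> = form \<K> f (kernel_section X (series_kernel a) y)"
      unfolding sec *(3) by (rule formK[OF *(1) p(1) *(2) mN, symmetric])
    finally show "f y = form \<K> f (kernel_section X (series_kernel a) y)" .
  qed
qed

end

theory Submission
  imports Defs
begin

text \<open>
  The function set of the induced Krein space depends on the coefficients \<open>a\<^sub>j\<close> only through their
  absolute values, and \<open>\<bar>c\<^sub>j a\<^sub>j\<bar> = \<bar>a\<^sub>j\<bar>\<close>. More precisely, the induced space consists of the sums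
  \<open>f + g\<close> with \<open>f \<in> H(K\<^sub>+)\<close> and \<open>g \<in> H(-K\<^sub>-)\<close>, and by Aronszajn's sum theorem
  \<open>H(K\<^sub>1) + H(K\<^sub>2) = H(K\<^sub>1 + K\<^sub>2)\<close> as sets, so it is \<open>H(\<Sum>\<^sub>j \<bar>a\<^sub>j\<bar> (y\<^sup>* x)\<^sup>j)\<close>
  (lemma \<open>funs_induced_krein_space\<close>).

  Two classical facts have to be established for this. The first is the Moore-Aronszajn theorem: a
  positive semidefinite kernel has exactly one reproducing kernel Hilbert space
  (\<open>limit_space_rkhs\<close>, \<open>rkhs_unique\<close>). The kernel makes the finitely supported coefficient functions
  into a semi-inner product space; the Hilbert space consists of the pointwise limits of the kernel
  combinations along its Cauchy sequences. The second is the sum theorem \<open>funs_rkhs_sum\<close>. One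
  inclusion holds since a sequence that is Cauchy for \<open>K\<^sub>1 + K\<^sub>2\<close> is Cauchy for both summands. The
  other one, as well as uniqueness, rests on a criterion for membership (\<open>mem_limit_spaceI\<close>): a
  function belongs to \<open>H(K)\<close> as soon as the functional that it induces on coefficient functions is bounded by the kernel
  seminorm. It comes from a version of the Riesz representation theorem for incomplete spaces, in which
  the representing vector is replaced by a Cauchy sequence (\<open>riesz_sequence\<close>).
\<close>

section \<open>Semi-inner product spaces of functions\<close>

definition seminorm_of :: "(('a \<Rightarrow> complex) \<Rightarrow> ('a \<Rightarrow> complex) \<Rightarrow> complex) \<Rightarrow> ('a \<Rightarrow> complex) \<Rightarrow> real" where
  "seminorm_of b f = sqrt (Re (b f f))"

text \<open>
  The form may be degenerate, as the form of a kernel on coefficient functions usually is; the locale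
  covers these spaces and the Hilbert spaces of functions alike.
\<close>

locale semi_inner_space =
  fixes X :: "'a set" and V :: "('a \<Rightarrow> complex) set"
    and b :: "('a \<Rightarrow> complex) \<Rightarrow> ('a \<Rightarrow> complex) \<Rightarrow> complex"
  assumes function_space: "function_space_on X V"
    and hermitian: "hermitian_form_on V b"
    and nonneg: "\<And>f. f \<in> V \<Longrightarrow> 0 \<le> Re (b f f)"
begin

abbreviation nrm where "nrm \<equiv> seminorm_of b"

definition cauchy_seq :: "(nat \<Rightarrow> 'a \<Rightarrow> complex) \<Rightarrow> bool" where
  "cauchy_seq s \<longleftrightarrow> (\<forall>i. s i \<in> V) \<and> (\<forall>e>0. \<exists>N. \<forall>m\<ge>N. \<forall>n\<ge>N. nrm (s m - s n) < e)"

lemma zero_mem: "0 \<in> V"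
  and add_mem: "f \<in> V \<Longrightarrow> g \<in> V \<Longrightarrow> f + g \<in> V"
  and scale_mem: "f \<in> V \<Longrightarrow> (\<lambda>x. t * f x) \<in> V"
  and vanishes: "f \<in> V \<Longrightarrow> x \<notin> X \<Longrightarrow> f x = 0"
  using function_space by (auto simp: function_space_on_def)

lemma diff_mem: "f \<in> V \<Longrightarrow> g \<in> V \<Longrightarrow> f - g \<in> V"
  by (rule function_space_on_diff[OF function_space])

lemma add_left: "f \<in> V \<Longrightarrow> g \<in> V \<Longrightarrow> h \<in> V \<Longrightarrow> b (f + g) h = b f h + b g h"
  and scale_left: "f \<in> V \<Longrightarrow> g \<in> V \<Longrightarrow> b (\<lambda>x. t * f x) g = t * b f g"
  and sym: "f \<in> V \<Longrightarrow> g \<in> V \<Longrightarrow> b g f = cnj (b f g)"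
  using hermitian unfolding hermitian_form_on_def by blast+

lemma add_right: "f \<in> V \<Longrightarrow> g \<in> V \<Longrightarrow> h \<in> V \<Longrightarrow> b f (g + h) = b f g + b f h"
  by (rule hermitian_form_on_add_right[OF function_space hermitian])

lemma scale_right: "f \<in> V \<Longrightarrow> g \<in> V \<Longrightarrow> b f (\<lambda>x. t * g x) = cnj t * b f g"
  using sym[of "\<lambda>x. t * g x" f] sym[of f g] scale_left[of g f t] scale_mem[of g t]
  by simp

lemma diff_left: "f \<in> V \<Longrightarrow> g \<in> V \<Longrightarrow> h \<in> V \<Longrightarrow> b (f - g) h = b f h - b g h"
  using add_left[of "f - g" g h] diff_mem[of f g] by (simp add: algebra_simps)

lemma diff_right: "f \<in> V \<Longrightarrow> g \<in> V \<Longrightarrow> h \<in> V \<Longrightarrow> b f (g - h) = b f g - b f h"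
  using add_right[of f "g - h" h] diff_mem[of g h] by (simp add: algebra_simps)

lemma self_real: "f \<in> V \<Longrightarrow> b f f = of_real (Re (b f f))"
  using sym[of f f] by (simp add: complex_eq_iff)

lemma nrm_nonneg: "f \<in> V \<Longrightarrow> 0 \<le> nrm f"
  by (simp add: seminorm_of_def nonneg)

lemma nrm_square: "f \<in> V \<Longrightarrow> (nrm f)\<^sup>2 = Re (b f f)"
  by (simp add: seminorm_of_def nonneg)

lemma square_expand:
  assumes "f \<in> V" "g \<in> V"
  shows "Re (b (f + (\<lambda>x. t * g x)) (f + (\<lambda>x. t * g x)))
    = Re (b f f) + 2 * Re (t * b g f) + (cmod t)\<^sup>2 * Re (b g g)"
proof -
  let ?h = "\<lambda>x. t * g x"
  have h: "?h \<in> V" by (rule scale_mem[OF assms(2)])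
  have "b (f + ?h) (f + ?h) = b f f + b f ?h + (b ?h f + b ?h ?h)"
    using add_left[OF assms(1) h add_mem[OF assms(1) h]] add_right[OF assms(1) assms(1) h]
      add_right[OF h assms(1) h] by simp
  moreover have "b ?h f = t * b g f" "b f ?h = cnj (t * b g f)" "b ?h ?h = (t * cnj t) * b g g"
    using scale_left[OF assms(2,1)] sym[OF h assms(1)] scale_left[OF assms(2) h]
      scale_right[OF assms(2,2)] by simp_all
  moreover have "t * cnj t = of_real ((cmod t)\<^sup>2)"
    by (rule complex_norm_square[symmetric])
  ultimately show ?thesis
    using self_real[OF assms(2)] by (simp add: Re_complex_of_real flip: of_real_power)
qed

lemma cauchy_schwarz:
  assumes "f \<in> V" "g \<in> V"
  shows "cmod (b f g) \<le> nrm f * nrm g"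
proof -
  define p where "p = b f g"
  define F where "F = Re (b f f)"
  define G where "G = Re (b g g)"
  have FG: "0 \<le> F" "0 \<le> G" using assms by (auto simp: F_def G_def nonneg)
  \<comment> \<open>Nonnegativity of the form at \<open>f - r p g\<close>, with \<open>p\<close> the product of \<open>f\<close> and \<open>g\<close>.\<close>
  have q: "0 \<le> F - 2 * r * (cmod p)\<^sup>2 + r\<^sup>2 * (cmod p)\<^sup>2 * G" for r :: real
  proof -
    let ?t = "- of_real r * p"
    have "?t * b g f = - of_real (r * (cmod p)\<^sup>2)"
      using sym[OF assms] by (simp add: p_def complex_norm_square[symmetric] flip: of_real_power)
    then have "Re (?t * b g f) = - (r * (cmod p)\<^sup>2)"
      by (metis Re_complex_of_real uminus_complex.sel(1))
    moreover have "(cmod ?t)\<^sup>2 = r\<^sup>2 * (cmod p)\<^sup>2"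
      by (simp add: norm_mult power_mult_distrib)
    ultimately show ?thesis
      using square_expand[OF assms, of ?t]
        nonneg[OF add_mem[OF assms(1) scale_mem[OF assms(2), of ?t]]]
      by (simp add: F_def G_def)
  qed
  have "(cmod p)\<^sup>2 \<le> F * G"
  proof (cases "G = 0")
    case True
    have "(cmod p)\<^sup>2 = 0"
    proof (rule ccontr)
      assume ne: "(cmod p)\<^sup>2 \<noteq> 0"
      have "0 \<le> F - 2 * (F + 1)"
        using q[of "(F + 1) / (cmod p)\<^sup>2"] ne True by simp
      then show False using FG by simp
    qed
    then show ?thesis using True by simp
  next
    case False
    then have "0 < G" using FG by simp
    then have "0 \<le> F - (cmod p)\<^sup>2 / G"
      using q[of "1 / G"] by (simp add: power2_eq_square field_simps)
    then show ?thesis using \<open>0 < G\<close> by (simp add: field_simps)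
  qed
  then have "cmod p \<le> sqrt (F * G)" by (simp add: real_le_rsqrt)
  then show ?thesis by (simp add: p_def F_def G_def seminorm_of_def real_sqrt_mult)
qed

lemma nrm_add:
  assumes "f \<in> V" "g \<in> V"
  shows "nrm (f + g) \<le> nrm f + nrm g"
proof (rule power2_le_imp_le)
  have "(nrm (f + g))\<^sup>2 = (nrm f)\<^sup>2 + 2 * Re (b g f) + (nrm g)\<^sup>2"
    using square_expand[OF assms, of 1] assms by (simp add: nrm_square add_mem)
  also have "Re (b g f) \<le> nrm f * nrm g"
    using cauchy_schwarz[OF assms(2,1)] complex_Re_le_cmod[of "b g f"]
    by (simp add: mult.commute)
  finally show "(nrm (f + g))\<^sup>2 \<le> (nrm f + nrm g)\<^sup>2"
    by (simp add: power2_sum)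
qed (simp add: nrm_nonneg assms)

lemma nrm_scale: "f \<in> V \<Longrightarrow> nrm (\<lambda>x. t * f x) = cmod t * nrm f"
  using square_expand[OF zero_mem, of f t] hermitian_form_on_zero[OF function_space hermitian]
  by (simp add: seminorm_of_def real_sqrt_mult zero_mem)

lemma nrm_diff_commute:
  assumes "f \<in> V" "g \<in> V"
  shows "nrm (f - g) = nrm (g - f)"
proof -
  have "(\<lambda>x. (-1) * (g - f) x) = f - g" by auto
  then show ?thesis using nrm_scale[OF diff_mem[OF assms(2,1)], of "-1"] by simp
qed

lemma nrm_diff_triangle:
  assumes "f \<in> V" "g \<in> V" "h \<in> V"
  shows "nrm (f - h) \<le> nrm (f - g) + nrm (g - h)"
  using nrm_add[OF diff_mem[OF assms(1,2)] diff_mem[OF assms(2,3)]] by simp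

lemma nrm_reverse_triangle:
  assumes "f \<in> V" "g \<in> V"
  shows "\<bar>nrm f - nrm g\<bar> \<le> nrm (f - g)"
  using nrm_add[OF diff_mem[OF assms] assms(2)] nrm_add[OF diff_mem[OF assms(2,1)] assms(1)]
    nrm_diff_commute[OF assms] by simp

lemma cauchy_seq_mem: "cauchy_seq s \<Longrightarrow> s i \<in> V"
  by (simp add: cauchy_seq_def)

lemma cauchy_seq_eventually:
  assumes "cauchy_seq s" "0 < e"
  shows "\<exists>N. \<forall>m\<ge>N. \<forall>n\<ge>N. nrm (s m - s n) < e"
  using assms by (simp add: cauchy_seq_def)

lemma cauchy_seq_const: "f \<in> V \<Longrightarrow> cauchy_seq (\<lambda>i. f)"
  using hermitian_form_on_zero[OF function_space hermitian zero_mem]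
  by (simp add: cauchy_seq_def seminorm_of_def)

lemma cauchy_seq_add:
  assumes "cauchy_seq s" "cauchy_seq t"
  shows "cauchy_seq (\<lambda>i. s i + t i)"
  unfolding cauchy_seq_def
proof (intro conjI allI impI)
  fix e :: real assume "0 < e"
  then obtain M N where M: "\<forall>m\<ge>M. \<forall>n\<ge>M. nrm (s m - s n) < e / 2"
    and N: "\<forall>m\<ge>N. \<forall>n\<ge>N. nrm (t m - t n) < e / 2"
    using cauchy_seq_eventually[OF assms(1), of "e / 2"]
      cauchy_seq_eventually[OF assms(2), of "e / 2"] by auto
  have "nrm (s m + t m - (s n + t n)) < e" if "max M N \<le> m" "max M N \<le> n" for m n
  proof -
    have "nrm ((s m - s n) + (t m - t n)) \<le> nrm (s m - s n) + nrm (t m - t n)"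
      by (intro nrm_add diff_mem cauchy_seq_mem assms)
    moreover have "nrm (s m - s n) < e / 2" "nrm (t m - t n) < e / 2"
      using that M N by simp_all
    moreover have "(s m - s n) + (t m - t n) = s m + t m - (s n + t n)"
      by (rule add_diff_add[symmetric])
    ultimately show ?thesis by simp
  qed
  then show "\<exists>N. \<forall>m\<ge>N. \<forall>n\<ge>N. nrm (s m + t m - (s n + t n)) < e" by blast
qed (intro add_mem cauchy_seq_mem assms)

lemma cauchy_seq_scale:
  assumes "cauchy_seq s"
  shows "cauchy_seq (\<lambda>i x. t * s i x)"
  unfolding cauchy_seq_def
proof (intro conjI allI impI)
  fix e :: real assume "0 < e"
  then have "0 < e / (cmod t + 1)" by (simp add: add_nonneg_pos)
  then obtain N where N: "\<forall>m\<ge>N. \<forall>n\<ge>N. nrm (s m - s n) < e / (cmod t + 1)"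
    using cauchy_seq_eventually[OF assms] by blast
  have "nrm ((\<lambda>x. t * s m x) - (\<lambda>x. t * s n x)) < e" if "N \<le> m" "N \<le> n" for m n
  proof -
    have d: "s m - s n \<in> V" by (intro diff_mem cauchy_seq_mem assms)
    have "(\<lambda>x. t * s m x) - (\<lambda>x. t * s n x) = (\<lambda>x. t * (s m - s n) x)"
      by (auto simp: algebra_simps)
    then have "nrm ((\<lambda>x. t * s m x) - (\<lambda>x. t * s n x)) = cmod t * nrm (s m - s n)"
      using nrm_scale[OF d] by simp
    also have "\<dots> \<le> (cmod t + 1) * nrm (s m - s n)"
      using nrm_nonneg[OF d] by (simp add: mult_right_mono)
    also have "\<dots> < (cmod t + 1) * (e / (cmod t + 1))"
      using N that by (intro mult_strict_left_mono) (auto simp: add_nonneg_pos)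
    also have "\<dots> = e" by (simp add: add_nonneg_eq_0_iff)
    finally show ?thesis .
  qed
  then show "\<exists>N. \<forall>m\<ge>N. \<forall>n\<ge>N. nrm ((\<lambda>x. t * s m x) - (\<lambda>x. t * s n x)) < e" by blast
qed (intro scale_mem cauchy_seq_mem assms)

lemma cauchy_seq_bounded:
  assumes "cauchy_seq s"
  obtains B where "0 < B" "\<And>i. nrm (s i) \<le> B"
proof -
  have "Cauchy (\<lambda>i. nrm (s i))"
  proof (rule metric_CauchyI)
    fix e :: real assume "0 < e"
    then obtain N where N: "\<forall>m\<ge>N. \<forall>n\<ge>N. nrm (s m - s n) < e"
      using cauchy_seq_eventually[OF assms] by blast
    have "dist (nrm (s m)) (nrm (s n)) < e" if "N \<le> m" "N \<le> n" for m n
    proof -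
      have "\<bar>nrm (s m) - nrm (s n)\<bar> \<le> nrm (s m - s n)"
        by (intro nrm_reverse_triangle cauchy_seq_mem assms)
      also have "\<dots> < e" using N that by blast
      finally show ?thesis by (simp add: dist_real_def)
    qed
    then show "\<exists>N. \<forall>m\<ge>N. \<forall>n\<ge>N. dist (nrm (s m)) (nrm (s n)) < e" by blast
  qed
  then have "Bseq (\<lambda>i. nrm (s i))" by (simp add: Cauchy_Bseq)
  then obtain B where "0 < B" "\<And>i. norm (nrm (s i)) \<le> B" by (auto elim: BseqE)
  then show thesis using that[of B] by (metis abs_le_D1 real_norm_def)
qed

lemma cauchy_seq_form_convergent:
  assumes s: "cauchy_seq s" and t: "cauchy_seq t"
  shows "convergent (\<lambda>i. b (s i) (t i))"
proof -
  obtain B where B: "0 < B" "\<And>i. nrm (s i) \<le> B" using cauchy_seq_bounded[OF s] by blast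
  obtain C where C: "0 < C" "\<And>i. nrm (t i) \<le> C" using cauchy_seq_bounded[OF t] by blast
  have "Cauchy (\<lambda>i. b (s i) (t i))"
  proof (rule metric_CauchyI)
    fix e :: real assume e: "0 < e"
    obtain M where M: "\<forall>m\<ge>M. \<forall>n\<ge>M. nrm (s m - s n) < e / (2 * C)"
      using cauchy_seq_eventually[OF s, of "e / (2 * C)"] e C by auto
    obtain N where N: "\<forall>m\<ge>N. \<forall>n\<ge>N. nrm (t m - t n) < e / (2 * B)"
      using cauchy_seq_eventually[OF t, of "e / (2 * B)"] e B by auto
    have "dist (b (s m) (t m)) (b (s n) (t n)) < e" if "max M N \<le> m" "max M N \<le> n" for m n
    proof -
      note mem = cauchy_seq_mem[OF s] cauchy_seq_mem[OF t]
      have "b (s m) (t m) - b (s n) (t n) = b (s m - s n) (t m) + b (s n) (t m - t n)"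
        using mem by (simp add: diff_left diff_right)
      then have "cmod (b (s m) (t m) - b (s n) (t n))
          \<le> cmod (b (s m - s n) (t m)) + cmod (b (s n) (t m - t n))"
        by (metis norm_triangle_ineq)
      also have "\<dots> \<le> nrm (s m - s n) * nrm (t m) + nrm (s n) * nrm (t m - t n)"
        by (intro add_mono cauchy_schwarz diff_mem mem)
      also have "\<dots> \<le> nrm (s m - s n) * C + B * nrm (t m - t n)"
        using B C by (intro add_mono mult_mono nrm_nonneg diff_mem mem) (auto simp: less_imp_le)
      also have "\<dots> < e / (2 * C) * C + B * (e / (2 * B))"
        using M N B C that
        by (intro add_strict_mono mult_strict_right_mono mult_strict_left_mono) auto
      also have "\<dots> = e" using B C by simp
      finally show ?thesis by (simp add: dist_norm)
    qed
    then show "\<exists>N. \<forall>m\<ge>N. \<forall>n\<ge>N. dist (b (s m) (t m)) (b (s n) (t n)) < e" by blast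
  qed
  then show ?thesis by (simp add: Cauchy_convergent)
qed

lemma form_tendsto_zero:
  assumes s: "\<And>i. s i \<in> V" and t: "\<And>i. t i \<in> V"
    and lim: "(\<lambda>i. nrm (s i)) \<longlonglongrightarrow> 0" and bdd: "\<And>i. nrm (t i) \<le> B"
  shows "(\<lambda>i. b (s i) (t i)) \<longlonglongrightarrow> 0"
proof (rule Lim_null_comparison)
  have "norm (b (s i) (t i)) \<le> nrm (s i) * B" for i
    using cauchy_schwarz[OF s t] mult_left_mono[OF bdd nrm_nonneg[OF s]]
    by (rule order_trans)
  then show "\<forall>\<^sub>F i in sequentially. norm (b (s i) (t i)) \<le> nrm (s i) * B"
    by simp
  show "(\<lambda>i. nrm (s i) * B) \<longlonglongrightarrow> 0"
    using tendsto_mult_left_zero[OF lim] by simp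
qed

lemma form_tendsto:
  assumes s: "\<And>i. s i \<in> V" and t: "\<And>i. t i \<in> V" and f: "f \<in> V" and g: "g \<in> V"
    and lim: "(\<lambda>i. nrm (s i - f)) \<longlonglongrightarrow> 0" "(\<lambda>i. nrm (t i - g)) \<longlonglongrightarrow> 0"
  shows "(\<lambda>i. b (s i) (t i)) \<longlonglongrightarrow> b f g"
proof -
  have bound: "norm (b (s i) (t i) - b f g)
      \<le> nrm (s i - f) * nrm (t i - g) + nrm (s i - f) * nrm g + nrm f * nrm (t i - g)" for i
  proof -
    let ?x = "b (s i - f) (t i - g)" and ?y = "b (s i - f) g" and ?z = "b f (t i - g)"
    have e: "b (s i) (t i) - b f g = ?x + ?y + ?z"
      by (simp add: diff_left diff_right diff_mem s t f g)
    have "norm (b (s i) (t i) - b f g) \<le> norm ?x + norm ?y + norm ?z"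
      unfolding e by (rule order_trans[OF norm_triangle_ineq add_right_mono[OF norm_triangle_ineq]])
    then show ?thesis
      using cauchy_schwarz[OF diff_mem[OF s f] diff_mem[OF t g], of i i]
        cauchy_schwarz[OF diff_mem[OF s f] g, of i] cauchy_schwarz[OF f diff_mem[OF t g], of i]
      by linarith
  qed
  have "(\<lambda>i. nrm (s i - f) * nrm (t i - g) + nrm (s i - f) * nrm g + nrm f * nrm (t i - g))
      \<longlonglongrightarrow> 0 * 0 + 0 * nrm g + nrm f * 0"
    by (intro tendsto_add tendsto_mult tendsto_const lim)
  then have "(\<lambda>i. nrm (s i - f) * nrm (t i - g) + nrm (s i - f) * nrm g + nrm f * nrm (t i - g)) \<longlonglongrightarrow> 0"
    by simp
  from Lim_null_comparison[OF always_eventually[OF allI[OF bound]] this]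
  have "(\<lambda>i. b (s i) (t i) - b f g) \<longlonglongrightarrow> 0" .
  then show ?thesis by (simp add: LIM_zero_iff)
qed

lemma lincomb_mem:
  assumes "finite A" "\<And>y. y \<in> A \<Longrightarrow> g y \<in> V"
  shows "(\<lambda>x. \<Sum>y\<in>A. t y * g y x) \<in> V"
  using assms
proof (induction A rule: finite_induct)
  case empty
  then show ?case using zero_mem by (simp add: zero_fun_def)
next
  case (insert a A)
  have "(\<lambda>x. \<Sum>y\<in>insert a A. t y * g y x) = (\<lambda>x. t a * g a x) + (\<lambda>x. \<Sum>y\<in>A. t y * g y x)"
    using insert by (simp add: fun_eq_iff)
  then show ?case using insert add_mem scale_mem by simp
qed

lemma lincomb_right:
  assumes "finite A" "\<And>y. y \<in> A \<Longrightarrow> g y \<in> V" "f \<in> V"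
  shows "b f (\<lambda>x. \<Sum>y\<in>A. t y * g y x) = (\<Sum>y\<in>A. cnj (t y) * b f (g y))"
  using assms
proof (induction A rule: finite_induct)
  case empty
  then show ?case
    using hermitian_form_on_zero[OF function_space hermitian] by (simp add: zero_fun_def)
next
  case (insert a A)
  have "(\<lambda>x. \<Sum>y\<in>insert a A. t y * g y x) = (\<lambda>x. t a * g a x) + (\<lambda>x. \<Sum>y\<in>A. t y * g y x)"
    using insert by (simp add: fun_eq_iff)
  then show ?case
    using insert by (simp add: add_right scale_right scale_mem lincomb_mem)
qed

text \<open>
  A weak limit of a Cauchy sequence is also its strong limit: in \<open>\<parallel>s\<^sub>i\<parallel>\<^sup>2 = b(s\<^sub>i, s\<^sub>i - s\<^sub>N) + b(s\<^sub>i, s\<^sub>N)\<close>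
  the first summand is small for a suitable fixed \<open>N\<close> and all large \<open>i\<close>, and the second one tends to 0.
\<close>

lemma cauchy_seq_weakly_null:
  assumes s: "cauchy_seq s" and w: "\<And>v. v \<in> V \<Longrightarrow> (\<lambda>i. b (s i) v) \<longlonglongrightarrow> 0"
  shows "(\<lambda>i. nrm (s i)) \<longlonglongrightarrow> 0"
proof -
  note mem = cauchy_seq_mem[OF s]
  obtain B where B: "0 < B" "\<And>i. nrm (s i) \<le> B" using cauchy_seq_bounded[OF s] by blast
  have "(\<lambda>i. (nrm (s i))\<^sup>2) \<longlonglongrightarrow> 0"
  proof (rule LIMSEQ_I)
    fix e :: real assume e: "0 < e"
    obtain N where N: "\<forall>m\<ge>N. \<forall>n\<ge>N. nrm (s m - s n) < e / (2 * B)"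
      using cauchy_seq_eventually[OF s, of "e / (2 * B)"] e B by auto
    obtain M where M: "\<forall>i\<ge>M. norm (b (s i) (s N) - 0) < e / 2"
      using LIMSEQ_D[OF w[OF mem[of N]], of "e / 2"] e by auto
    have "norm ((nrm (s i))\<^sup>2 - 0) < e" if i: "max M N \<le> i" for i
    proof -
      have "b (s i) (s i) = b (s i) (s i - s N) + b (s i) (s N)"
        using mem by (simp add: diff_right)
      then have "(nrm (s i))\<^sup>2 \<le> cmod (b (s i) (s i - s N)) + cmod (b (s i) (s N))"
        using nrm_square[OF mem[of i]] complex_Re_le_cmod[of "b (s i) (s i)"] norm_triangle_ineq
        by (metis order_trans)
      also have "cmod (b (s i) (s i - s N)) \<le> B * nrm (s i - s N)"
        using cauchy_schwarz[OF mem diff_mem[OF mem mem]]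
          mult_right_mono[OF B(2) nrm_nonneg[OF diff_mem[OF mem mem]]]
        by (rule order_trans)
      also have "B * nrm (s i - s N) < B * (e / (2 * B))"
        using N i B by (intro mult_strict_left_mono) auto
      also have "B * (e / (2 * B)) = e / 2" using B by simp
      finally show ?thesis using M i by fastforce
    qed
    then show "\<exists>N. \<forall>i\<ge>N. norm ((nrm (s i))\<^sup>2 - 0) < e" by blast
  qed
  then have "(\<lambda>i. sqrt ((nrm (s i))\<^sup>2)) \<longlonglongrightarrow> sqrt 0" by (rule tendsto_real_sqrt)
  then show ?thesis using nrm_nonneg[OF mem] by simp
qed

text \<open>
  The variational proof of the Riesz representation theorem. Let \<open>s\<close> be a maximizing sequence of the
  concave functional \<open>J(v) = 2 Re \<phi>(v) - \<parallel>v\<parallel>\<^sup>2\<close>, which is bounded above by \<open>C\<^sup>2\<close>. Comparison with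
  midpoints shows that \<open>s\<close> is Cauchy. The first variation of \<open>J\<close> at \<open>s\<^sub>i\<close> in the direction \<open>t v\<close> is
  \<open>2 Re (t (\<phi>(v) - b(v, s\<^sub>i)))\<close> and must tend to 0. In the absence of completeness the sequence
  itself plays the part of the representing vector.
\<close>

lemma riesz_sequence:
  assumes add: "\<And>v w. v \<in> V \<Longrightarrow> w \<in> V \<Longrightarrow> \<phi> (v + w) = \<phi> v + \<phi> w"
    and scale: "\<And>t v. v \<in> V \<Longrightarrow> \<phi> (\<lambda>x. t * v x) = t * \<phi> v"
    and bdd: "\<And>v. v \<in> V \<Longrightarrow> cmod (\<phi> v) \<le> C * nrm v"
  obtains s where "cauchy_seq s" "\<And>v. v \<in> V \<Longrightarrow> (\<lambda>i. b v (s i)) \<longlonglongrightarrow> \<phi> v"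
proof -
  define J where "J v = 2 * Re (\<phi> v) - (nrm v)\<^sup>2" for v
  have J_le: "J v \<le> C\<^sup>2" if "v \<in> V" for v
  proof -
    have "Re (\<phi> v) \<le> C * nrm v"
      using bdd[OF that] complex_Re_le_cmod order_trans by blast
    moreover have "0 \<le> (C - nrm v)\<^sup>2" by simp
    ultimately show ?thesis by (simp add: J_def power2_diff)
  qed
  have bddJ: "bdd_above (J ` V)" using J_le by (auto intro!: bdd_aboveI)
  define M where "M = Sup (J ` V)"
  have J_M: "J v \<le> M" if "v \<in> V" for v
    unfolding M_def using that bddJ by (intro cSup_upper) auto
  have "\<exists>v\<in>V. M - 1 / (real i + 1) < J v" for i
  proof -
    have "M - 1 / (real i + 1) < Sup (J ` V)" unfolding M_def by simp
    then show ?thesis using less_cSup_iff[OF _ bddJ] zero_mem by blast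
  qed
  then obtain s where s: "\<And>i. s i \<in> V" and Js: "\<And>i. M - 1 / (real i + 1) < J (s i)"
    by metis
  have J_step: "J (u + (\<lambda>x. t * v x)) = J u + 2 * Re (t * (\<phi> v - b v u)) - (cmod t)\<^sup>2 * (nrm v)\<^sup>2"
    if "u \<in> V" "v \<in> V" for u v t
    unfolding J_def using that square_expand[OF that, of t]
    by (simp add: add scale scale_mem nrm_square add_mem algebra_simps)
  \<comment> \<open>Parallelogram law, in the form \<open>J u + J v = 2 J ((u + v)/2) - \<parallel>u - v\<parallel>\<^sup>2 / 2\<close>.\<close>
  have gap: "(nrm (u - v))\<^sup>2 \<le> 4 * M - 2 * J u - 2 * J v" if uv: "u \<in> V" "v \<in> V" for u v
  proof -
    let ?d = "u - v"
    have d: "?d \<in> V" by (rule diff_mem[OF uv])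
    have half: "v + (\<lambda>x. (1/2) * ?d x) \<in> V" by (intro add_mem scale_mem d uv)
    have full: "v + (\<lambda>x. 1 * ?d x) = u" by auto
    have "J u = J v + 2 * Re (\<phi> ?d - b ?d v) - (nrm ?d)\<^sup>2"
      using J_step[OF uv(2) d, of 1] unfolding full by simp
    moreover have "J (v + (\<lambda>x. (1/2) * ?d x)) = J v + Re (\<phi> ?d - b ?d v) - (nrm ?d)\<^sup>2 / 4"
      using J_step[OF uv(2) d, of "1/2"] by (simp add: power2_eq_square)
    ultimately show ?thesis using J_M[OF half] by simp
  qed
  have cau: "cauchy_seq s"
    unfolding cauchy_seq_def
  proof (intro conjI allI impI s)
    fix e :: real assume e: "0 < e"
    obtain N :: nat where N: "4 / e\<^sup>2 < real N" using reals_Archimedean2 by blast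
    have "nrm (s m - s n) < e" if "N \<le> m" "N \<le> n" for m n
    proof (rule power2_less_imp_less)
      have small: "1 / (real i + 1) < e\<^sup>2 / 4" if "N \<le> i" for i
      proof -
        have "4 / e\<^sup>2 < real i + 1" using N that by linarith
        then show ?thesis using e by (simp add: field_simps)
      qed
      show "(nrm (s m - s n))\<^sup>2 < e\<^sup>2"
        using gap[OF s s, of m n] Js[of m] Js[of n] small[OF that(1)] small[OF that(2)] by linarith
    qed (use e in simp)
    then show "\<exists>N. \<forall>m\<ge>N. \<forall>n\<ge>N. nrm (s m - s n) < e" by blast
  qed
  have "(\<lambda>i. b v (s i)) \<longlonglongrightarrow> \<phi> v" if v: "v \<in> V" for v
  proof -
    \<comment> \<open>With \<open>d = \<phi> v - b v (s i)\<close>, the step \<open>r cnj d v\<close> from \<open>s i\<close> raises \<open>J\<close> by at least \<open>r (cmod d)\<^sup>2\<close>,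
      because \<open>r \<parallel>v\<parallel>\<^sup>2 \<le> 1\<close>; this cannot exceed the distance of \<open>J (s i)\<close> to the supremum.\<close>
    define r where "r = 1 / (1 + (nrm v)\<^sup>2)"
    have r: "0 < r" "r * (nrm v)\<^sup>2 \<le> 1" by (simp_all add: r_def add_pos_nonneg)
    have bound: "(cmod (b v (s i) - \<phi> v))\<^sup>2 \<le> (1 / r) * (1 / (real i + 1))" for i
    proof -
      define d where "d = \<phi> v - b v (s i)"
      let ?t = "of_real r * cnj d"
      have "?t * d = of_real (r * (cmod d)\<^sup>2)"
        by (simp add: complex_norm_square mult.commute[of d "cnj d"] del: of_real_power flip: of_real_power)
      then have "Re (?t * d) = r * (cmod d)\<^sup>2"
        by (metis Re_complex_of_real)
      moreover have "(cmod ?t)\<^sup>2 = r\<^sup>2 * (cmod d)\<^sup>2"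
        using r by (simp add: norm_mult power_mult_distrib)
      moreover have "J (s i + (\<lambda>x. ?t * v x)) \<le> M"
        by (intro J_M add_mem scale_mem s v)
      ultimately have "2 * (r * (cmod d)\<^sup>2) - r\<^sup>2 * (cmod d)\<^sup>2 * (nrm v)\<^sup>2 \<le> 1 / (real i + 1)"
        using J_step[OF s[of i] v, of ?t] Js[of i] unfolding d_def by simp
      moreover have "r\<^sup>2 * (cmod d)\<^sup>2 * (nrm v)\<^sup>2 \<le> r * (cmod d)\<^sup>2"
        using mult_left_mono[OF r(2), of "r * (cmod d)\<^sup>2"] r
        by (simp add: power2_eq_square algebra_simps)
      ultimately have "(cmod d)\<^sup>2 * r \<le> 1 / (real i + 1)" by (simp add: mult.commute)
      then have "(cmod d)\<^sup>2 \<le> 1 / (real i + 1) / r" using r by (simp only: pos_le_divide_eq)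
      moreover have "cmod d = cmod (b v (s i) - \<phi> v)" by (simp add: d_def norm_minus_commute)
      ultimately show ?thesis by (simp add: mult.commute)
    qed
    have "(\<lambda>i. (1 / r) * (1 / (real i + 1))) \<longlonglongrightarrow> (1 / r) * 0"
      using LIMSEQ_inverse_real_of_nat by (intro tendsto_mult tendsto_const) (simp add: inverse_eq_divide add.commute)
    then have "(\<lambda>i. (1 / r) * (1 / (real i + 1))) \<longlonglongrightarrow> 0" by simp
    then have "(\<lambda>i. (cmod (b v (s i) - \<phi> v))\<^sup>2) \<longlonglongrightarrow> 0"
      by (rule Lim_null_comparison[rotated]) (use bound in auto)
    then have "(\<lambda>i. sqrt ((cmod (b v (s i) - \<phi> v))\<^sup>2)) \<longlonglongrightarrow> sqrt 0"
      by (rule tendsto_real_sqrt)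
    then have "(\<lambda>i. b v (s i) - \<phi> v) \<longlonglongrightarrow> 0"
      by (simp add: tendsto_norm_zero_iff)
    then show ?thesis by (simp add: LIM_zero_iff)
  qed
  then show thesis using that cau by blast
qed

end

section \<open>Positive semidefinite kernels\<close>

definition finsupp_on :: "'a set \<Rightarrow> ('a \<Rightarrow> complex) set" where
  "finsupp_on X = {c. finite {x. c x \<noteq> 0} \<and> (\<forall>x. x \<notin> X \<longrightarrow> c x = 0)}"

text \<open>
  The order of the arguments of \<open>K\<close> is the one for which \<open>delta y\<close> and \<open>delta x\<close> have the product \<open>K x y\<close>,
  the value of the section at \<open>y\<close> in the point \<open>x\<close>. With it, passing from coefficients to kernel combinations
  is an isometry into each space in which \<open>K\<close> reproduces.
\<close>

definition kernel_form ::
    "('a \<Rightarrow> 'a \<Rightarrow> complex) \<Rightarrow> ('a \<Rightarrow> complex) \<Rightarrow> ('a \<Rightarrow> complex) \<Rightarrow> complex" where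
  "kernel_form K c d = (\<Sum>y | c y \<noteq> 0. \<Sum>x | d x \<noteq> 0. c y * cnj (d x) * K x y)"

definition kernel_comb ::
    "'a set \<Rightarrow> ('a \<Rightarrow> 'a \<Rightarrow> complex) \<Rightarrow> ('a \<Rightarrow> complex) \<Rightarrow> 'a \<Rightarrow> complex" where
  "kernel_comb X K c = (\<lambda>x. \<Sum>y | c y \<noteq> 0. c y * kernel_section X K y x)"

definition delta :: "'a \<Rightarrow> 'a \<Rightarrow> complex" where
  "delta y = (\<lambda>x. if x = y then 1 else 0)"

definition psd_kernel_on :: "'a set \<Rightarrow> ('a \<Rightarrow> 'a \<Rightarrow> complex) \<Rightarrow> bool" where
  "psd_kernel_on X K \<longleftrightarrow>
     (\<forall>x\<in>X. \<forall>y\<in>X. K y x = cnj (K x y)) \<and> (\<forall>c\<in>finsupp_on X. 0 \<le> Re (kernel_form K c c))"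

lemma finsupp_on_finite: "c \<in> finsupp_on X \<Longrightarrow> finite {x. c x \<noteq> 0}"
  and finsupp_on_subset: "c \<in> finsupp_on X \<Longrightarrow> {x. c x \<noteq> 0} \<subseteq> X"
  by (auto simp: finsupp_on_def)

lemma delta_mem: "y \<in> X \<Longrightarrow> delta y \<in> finsupp_on X"
  by (auto simp: finsupp_on_def delta_def)

lemma function_space_on_finsupp: "function_space_on X (finsupp_on X)"
proof -
  have "finite {x. f x + g x \<noteq> 0}"
    if "finite {x. f x \<noteq> 0}" "finite {x. g x \<noteq> 0}" for f g :: "'a \<Rightarrow> complex"
    by (rule finite_subset[OF _ finite_UnI[OF that]]) auto
  moreover have "finite {x. t * f x \<noteq> 0}" if "finite {x. f x \<noteq> 0}" for t and f :: "'a \<Rightarrow> complex"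
    by (rule finite_subset[OF _ that]) auto
  ultimately show ?thesis
    unfolding function_space_on_def finsupp_on_def by (auto simp del: mult_eq_0_iff)
qed

lemma kernel_form_superset:
  assumes "finite A" "{x. c x \<noteq> 0} \<subseteq> A" "{x. d x \<noteq> 0} \<subseteq> A"
  shows "kernel_form K c d = (\<Sum>y\<in>A. \<Sum>x\<in>A. c y * cnj (d x) * K x y)"
  unfolding kernel_form_def
proof (rule sum.mono_neutral_cong_left)
  fix y
  show "(\<Sum>x | d x \<noteq> 0. c y * cnj (d x) * K x y) = (\<Sum>x\<in>A. c y * cnj (d x) * K x y)"
    by (rule sum.mono_neutral_left) (use assms in auto)
qed (use assms in auto)

lemma kernel_form_add_left:
  assumes "c \<in> finsupp_on X" "d \<in> finsupp_on X" "e \<in> finsupp_on X"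
  shows "kernel_form K (c + d) e = kernel_form K c e + kernel_form K d e"
proof -
  let ?A = "{x. c x \<noteq> 0} \<union> {x. d x \<noteq> 0} \<union> {x. e x \<noteq> 0}"
  have A: "finite ?A" using assms by (auto simp: finsupp_on_def)
  show ?thesis
    by (subst (1 2 3) kernel_form_superset[OF A]) (auto simp: algebra_simps sum.distrib)
qed

lemma kernel_form_scale_left:
  assumes "c \<in> finsupp_on X" "d \<in> finsupp_on X"
  shows "kernel_form K (\<lambda>x. t * c x) d = t * kernel_form K c d"
proof -
  let ?A = "{x. c x \<noteq> 0} \<union> {x. d x \<noteq> 0}"
  have A: "finite ?A" using assms by (auto simp: finsupp_on_def)
  show ?thesis
    by (subst (1 2) kernel_form_superset[OF A]) (auto simp: algebra_simps sum_distrib_left)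
qed

lemma kernel_form_commute:
  assumes "c \<in> finsupp_on X" "d \<in> finsupp_on X"
    and K: "\<And>x y. x \<in> X \<Longrightarrow> y \<in> X \<Longrightarrow> K y x = cnj (K x y)"
  shows "kernel_form K d c = cnj (kernel_form K c d)"
proof -
  have "cnj (kernel_form K c d) = (\<Sum>y | c y \<noteq> 0. \<Sum>x | d x \<noteq> 0. d x * cnj (c y) * cnj (K x y))"
    unfolding kernel_form_def by (simp add: mult_ac)
  also have "\<dots> = (\<Sum>y | c y \<noteq> 0. \<Sum>x | d x \<noteq> 0. d x * cnj (c y) * K y x)"
  proof (intro sum.cong refl)
    fix y x assume "y \<in> {y. c y \<noteq> 0}" "x \<in> {x. d x \<noteq> 0}"
    then have "K y x = cnj (K x y)"
      using K finsupp_on_subset assms(1,2) by blast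
    then show "d x * cnj (c y) * cnj (K x y) = d x * cnj (c y) * K y x" by simp
  qed
  also have "\<dots> = kernel_form K d c"
    unfolding kernel_form_def by (rule sum.swap)
  finally show ?thesis by simp
qed

lemma kernel_form_eq_sum_comb:
  assumes "c \<in> finsupp_on X" "d \<in> finsupp_on X"
  shows "kernel_form K c d = (\<Sum>x | d x \<noteq> 0. cnj (d x) * kernel_comb X K c x)"
  unfolding kernel_form_def kernel_comb_def kernel_section_def sum_distrib_left
  by (subst sum.swap) (use assms in \<open>auto simp: finsupp_on_def mult_ac intro!: sum.cong\<close>)

lemma kernel_form_delta:
  assumes "c \<in> finsupp_on X" "x \<in> X"
  shows "kernel_form K c (delta x) = kernel_comb X K c x"
  unfolding kernel_form_eq_sum_comb[OF assms(1) delta_mem[OF assms(2)]]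
  by (simp add: delta_def)

lemma kernel_comb_delta: "kernel_comb X K (delta y) = kernel_section X K y"
  by (simp add: kernel_comb_def delta_def)

lemma kernel_comb_outside: "x \<notin> X \<Longrightarrow> kernel_comb X K c x = 0"
  by (simp add: kernel_comb_def kernel_section_def)

lemma kernel_comb_diff:
  assumes "c \<in> finsupp_on X" "d \<in> finsupp_on X"
  shows "kernel_comb X K (c - d) = kernel_comb X K c - kernel_comb X K d"
proof
  fix x
  let ?A = "{x. c x \<noteq> 0} \<union> {x. d x \<noteq> 0}"
  have A: "finite ?A" using assms by (auto simp: finsupp_on_def)
  have *: "kernel_comb X K e x = (\<Sum>y\<in>?A. e y * kernel_section X K y x)"
    if "{x. e x \<noteq> 0} \<subseteq> ?A" for e
    unfolding kernel_comb_def by (rule sum.mono_neutral_left) (use A that in auto)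
  have "kernel_comb X K (c - d) x = (\<Sum>y\<in>?A. (c - d) y * kernel_section X K y x)"
    by (rule *) auto
  also have "\<dots> = kernel_comb X K c x - kernel_comb X K d x"
    by (subst (1 2) *) (auto simp: algebra_simps sum_subtractf)
  finally show "kernel_comb X K (c - d) x = (kernel_comb X K c - kernel_comb X K d) x" by simp
qed

text \<open>
  The next lemmas concern any space in which \<open>K\<close> reproduces. There the form of a kernel combination
  is given by values of functions, which ties it to the form on coefficient functions.
\<close>

lemma hilbert_imp_semi_inner_space:
  assumes "hilbert_space_on X W"
  shows "semi_inner_space X (funs W) (form W)"
proof
  show *: "function_space_on X (funs W)" "hermitian_form_on (funs W) (form W)"
    using assms by (simp_all add: hilbert_space_on_def)
  fix f assume f: "f \<in> funs W"
  show "0 \<le> Re (form W f f)"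
  proof (cases "f = 0")
    case True
    then show ?thesis using hermitian_form_on_zero[OF * f] by simp
  next
    case False
    then show ?thesis using assms f by (simp add: hilbert_space_on_def less_imp_le)
  qed
qed

lemma
  assumes W: "semi_inner_space X (funs W) (form W)" and rep: "reproducing_on X K W"
    and c: "c \<in> finsupp_on X"
  shows reproducing_comb_mem: "kernel_comb X K c \<in> funs W"
    and reproducing_comb: "f \<in> funs W \<Longrightarrow>
      form W f (kernel_comb X K c) = (\<Sum>y | c y \<noteq> 0. cnj (c y) * f y)"
proof -
  interpret W: semi_inner_space X "funs W" "form W" by (rule W)
  have sec: "kernel_section X K y \<in> funs W" "f \<in> funs W \<Longrightarrow> form W f (kernel_section X K y) = f y"
    if "c y \<noteq> 0" for y f
    using rep finsupp_on_subset[OF c] that unfolding reproducing_on_def by auto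
  show "kernel_comb X K c \<in> funs W"
    unfolding kernel_comb_def by (rule W.lincomb_mem) (use finsupp_on_finite[OF c] sec in auto)
  assume f: "f \<in> funs W"
  show "form W f (kernel_comb X K c) = (\<Sum>y | c y \<noteq> 0. cnj (c y) * f y)"
    unfolding kernel_comb_def
    by (subst W.lincomb_right) (use finsupp_on_finite[OF c] sec f in auto)
qed

lemma reproducing_comb_comb:
  assumes "semi_inner_space X (funs W) (form W)" "reproducing_on X K W"
    and "c \<in> finsupp_on X" "d \<in> finsupp_on X"
  shows "form W (kernel_comb X K c) (kernel_comb X K d) = kernel_form K c d"
  using reproducing_comb[OF assms(1,2,4) reproducing_comb_mem[OF assms(1-3)]]
    kernel_form_eq_sum_comb[OF assms(3,4)] by metis

section \<open>The Moore-Aronszajn theorem\<close>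

locale psd_kernel =
  fixes X :: "'a set" and K :: "'a \<Rightarrow> 'a \<Rightarrow> complex"
  assumes psd: "psd_kernel_on X K"
begin

sublocale pre: semi_inner_space X "finsupp_on X" "kernel_form K"
proof
  show "hermitian_form_on (finsupp_on X) (kernel_form K)"
    unfolding hermitian_form_on_def
    using kernel_form_add_left kernel_form_scale_left kernel_form_commute psd
    unfolding psd_kernel_on_def by blast
qed (use psd function_space_on_finsupp in \<open>auto simp: psd_kernel_on_def\<close>)

definition represents :: "(nat \<Rightarrow> 'a \<Rightarrow> complex) \<Rightarrow> ('a \<Rightarrow> complex) \<Rightarrow> bool" where
  "represents s f \<longleftrightarrow> pre.cauchy_seq s \<and>
     (\<forall>x\<in>X. (\<lambda>i. kernel_comb X K (s i) x) \<longlonglongrightarrow> f x) \<and> (\<forall>x. x \<notin> X \<longrightarrow> f x = 0)"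

text \<open>
  The choice of the two sequences does not affect the limit (\<open>limit_form_tendsto\<close>). The form is set to
  0 outside the space since \<open>is_rkhs\<close> prescribes this.
\<close>

definition limit_form :: "('a \<Rightarrow> complex) \<Rightarrow> ('a \<Rightarrow> complex) \<Rightarrow> complex" where
  "limit_form f g =
     (if (\<exists>s. represents s f) \<and> (\<exists>t. represents t g)
      then lim (\<lambda>i. kernel_form K ((SOME s. represents s f) i) ((SOME t. represents t g) i))
      else 0)"

definition limit_space :: "'a form_space" where
  "limit_space = \<lparr>funs = {f. \<exists>s. represents s f}, form = limit_form\<rparr>"

lemma funs_limit_space: "f \<in> funs limit_space \<longleftrightarrow> (\<exists>s. represents s f)"
  and form_limit_space: "form limit_space = limit_form"
  by (simp_all add: limit_space_def)

lemma represents_cauchy: "represents s f \<Longrightarrow> pre.cauchy_seq s"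
  and represents_tendsto: "represents s f \<Longrightarrow> x \<in> X \<Longrightarrow> (\<lambda>i. kernel_comb X K (s i) x) \<longlonglongrightarrow> f x"
  and represents_outside: "represents s f \<Longrightarrow> x \<notin> X \<Longrightarrow> f x = 0"
  by (simp_all add: represents_def)

lemma represents_mem: "represents s f \<Longrightarrow> s i \<in> finsupp_on X"
  by (rule pre.cauchy_seq_mem[OF represents_cauchy])

lemma cauchy_seq_represents:
  assumes "pre.cauchy_seq s"
  obtains f where "represents s f"
proof -
  have "convergent (\<lambda>i. kernel_comb X K (s i) x)" if "x \<in> X" for x
    using pre.cauchy_seq_form_convergent[OF assms pre.cauchy_seq_const[OF delta_mem[OF that]]]
      kernel_form_delta[OF pre.cauchy_seq_mem[OF assms] that] by simp
  then have "represents s (\<lambda>x. if x \<in> X then lim (\<lambda>i. kernel_comb X K (s i) x) else 0)"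
    using assms by (simp add: represents_def convergent_LIMSEQ_iff)
  then show thesis by (rule that)
qed

lemma represents_zero: "represents (\<lambda>i. 0) 0"
  by (simp add: represents_def pre.cauchy_seq_const[OF pre.zero_mem] kernel_comb_def)

lemma represents_scale:
  assumes "represents s f"
  shows "represents (\<lambda>i x. t * s i x) (\<lambda>x. t * f x)"
proof -
  have "kernel_comb X K (\<lambda>x. t * s i x) x = t * kernel_comb X K (s i) x" if "x \<in> X" for i x
    using that represents_mem[OF assms, of i] pre.scale_mem[OF represents_mem[OF assms, of i], of t]
      kernel_form_scale_left[OF represents_mem[OF assms, of i] delta_mem[OF that]]
    by (metis kernel_form_delta)
  then show ?thesis
    using assms pre.cauchy_seq_scale unfolding represents_def
    by (auto intro!: tendsto_intros)
qed

lemma represents_add: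
  assumes "represents s f" "represents t g"
  shows "represents (\<lambda>i. s i + t i) (f + g)"
proof -
  have "kernel_comb X K (s i + t i) x = kernel_comb X K (s i) x + kernel_comb X K (t i) x"
    if x: "x \<in> X" for i x
  proof -
    note s = represents_mem[OF assms(1), of i] and t = represents_mem[OF assms(2), of i]
    show ?thesis
      using kernel_form_add_left[OF s t delta_mem[OF x], of K]
      unfolding kernel_form_delta[OF s x] kernel_form_delta[OF t x]
        kernel_form_delta[OF pre.add_mem[OF s t] x] .
  qed
  then show ?thesis
    using assms pre.cauchy_seq_add unfolding represents_def
    by (auto intro!: tendsto_intros)
qed

lemma represents_diff:
  assumes "represents s f" "represents t g"
  shows "represents (\<lambda>i. s i - t i) (f - g)"
proof -
  have e: "(\<lambda>i. s i - t i) = (\<lambda>i. s i + (\<lambda>x. (-1) * t i x))" "f - g = f + (\<lambda>x. (-1) * g x)"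
    by (auto simp: fun_eq_iff)
  show ?thesis
    unfolding e by (rule represents_add[OF assms(1) represents_scale[OF assms(2)]])
qed

lemma represents_const:
  assumes "c \<in> finsupp_on X"
  shows "represents (\<lambda>i. c) (kernel_comb X K c)"
  by (simp add: represents_def pre.cauchy_seq_const[OF assms] kernel_comb_outside)

text \<open>
  Well-definedness of the limit form: sequences with the same pointwise limit differ by a null sequence.
  Pointwise convergence to 0 is weak convergence to 0, since every coefficient function is a finite
  combination of \<open>delta\<close> functions.
\<close>

lemma represents_zero_null:
  assumes "represents s 0"
  shows "(\<lambda>i. pre.nrm (s i)) \<longlonglongrightarrow> 0"
proof (rule pre.cauchy_seq_weakly_null[OF represents_cauchy[OF assms]])
  fix v assume v: "v \<in> finsupp_on X"
  have "(\<lambda>i. \<Sum>x | v x \<noteq> 0. cnj (v x) * kernel_comb X K (s i) x) \<longlonglongrightarrow> (\<Sum>x | v x \<noteq> 0. cnj (v x) * 0)"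
    using represents_tendsto[OF assms] finsupp_on_subset[OF v]
    by (intro tendsto_sum tendsto_mult tendsto_const) auto
  then show "(\<lambda>i. kernel_form K (s i) v) \<longlonglongrightarrow> 0"
    using kernel_form_eq_sum_comb[OF represents_mem[OF assms] v] by simp
qed

lemma limit_form_tendsto:
  assumes s: "represents s f" and t: "represents t g"
  shows "(\<lambda>i. kernel_form K (s i) (t i)) \<longlonglongrightarrow> limit_form f g"
proof -
  define s' where "s' = (SOME s. represents s f)"
  define t' where "t' = (SOME t. represents t g)"
  have s': "represents s' f" and t': "represents t' g"
    unfolding s'_def t'_def by (rule someI[of _ s] someI[of _ t], fact)+
  note mem = represents_mem[OF s] represents_mem[OF s'] represents_mem[OF t] represents_mem[OF t']
  have "convergent (\<lambda>i. kernel_form K (s' i) (t' i))"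
    by (rule pre.cauchy_seq_form_convergent[OF represents_cauchy[OF s'] represents_cauchy[OF t']])
  then have lim: "(\<lambda>i. kernel_form K (s' i) (t' i)) \<longlonglongrightarrow> limit_form f g"
    using s t by (auto simp: limit_form_def s'_def t'_def convergent_LIMSEQ_iff)
  obtain B where B: "\<And>i. pre.nrm (t i) \<le> B"
    using pre.cauchy_seq_bounded[OF represents_cauchy[OF t]] by blast
  obtain C where C: "\<And>i. pre.nrm (s' i) \<le> C"
    using pre.cauchy_seq_bounded[OF represents_cauchy[OF s']] by blast
  have 1: "(\<lambda>i. kernel_form K (s i - s' i) (t i)) \<longlonglongrightarrow> 0"
    by (rule pre.form_tendsto_zero[OF _ _ represents_zero_null B])
      (use mem pre.diff_mem represents_diff[OF s s'] in auto)
  have "(\<lambda>i. kernel_form K (t i - t' i) (s' i)) \<longlonglongrightarrow> 0"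
    by (rule pre.form_tendsto_zero[OF _ _ represents_zero_null C])
      (use mem pre.diff_mem represents_diff[OF t t'] in auto)
  then have "(\<lambda>i. cnj (kernel_form K (t i - t' i) (s' i))) \<longlonglongrightarrow> cnj 0"
    by (rule tendsto_cnj)
  then have 2: "(\<lambda>i. kernel_form K (s' i) (t i - t' i)) \<longlonglongrightarrow> 0"
    using pre.sym[OF pre.diff_mem[OF mem(3,4)] mem(2)] by simp
  have "(\<lambda>i. kernel_form K (s' i) (t' i) + kernel_form K (s i - s' i) (t i)
      + kernel_form K (s' i) (t i - t' i)) \<longlonglongrightarrow> limit_form f g + 0 + 0"
    by (intro tendsto_add lim 1 2)
  moreover have "kernel_form K (s' i) (t' i) + kernel_form K (s i - s' i) (t i)
      + kernel_form K (s' i) (t i - t' i) = kernel_form K (s i) (t i)" for i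
    using mem by (simp add: pre.diff_left pre.diff_right)
  ultimately show ?thesis by simp
qed

lemma limit_form_eqI:
  assumes "represents s f" "represents t g" "(\<lambda>i. kernel_form K (s i) (t i)) \<longlonglongrightarrow> z"
  shows "limit_form f g = z"
  by (rule LIMSEQ_unique[OF limit_form_tendsto[OF assms(1,2)] assms(3)])

lemma limit_space_semi_inner: "semi_inner_space X (funs limit_space) (form limit_space)"
proof
  show "function_space_on X (funs limit_space)"
    unfolding function_space_on_def
  proof (intro conjI ballI allI impI)
    show "0 \<in> funs limit_space" using represents_zero by (auto simp: funs_limit_space)
    fix f assume "f \<in> funs limit_space"
    then obtain u where u: "represents u f" by (auto simp: funs_limit_space)
    show "f x = 0" if "x \<notin> X" for x by (rule represents_outside[OF u that])
    show "(\<lambda>x. t * f x) \<in> funs limit_space" for t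
      using represents_scale[OF u] by (auto simp: funs_limit_space)
    fix g assume "g \<in> funs limit_space"
    then show "f + g \<in> funs limit_space"
      using represents_add[OF u] by (auto simp: funs_limit_space)
  qed
  show "hermitian_form_on (funs limit_space) (form limit_space)"
    unfolding hermitian_form_on_def form_limit_space
  proof (intro conjI ballI allI)
    fix t f g h assume "f \<in> funs limit_space" "g \<in> funs limit_space"
    then obtain u v where u: "represents u f" and v: "represents v g"
      by (auto simp: funs_limit_space)
    note mem = represents_mem[OF u] represents_mem[OF v]
    show "limit_form (\<lambda>x. t * f x) g = t * limit_form f g"
      by (rule limit_form_eqI[OF represents_scale[OF u] v])
        (use mem tendsto_mult_left[OF limit_form_tendsto[OF u v], of t] in \<open>simp add: pre.scale_left\<close>)
    show "limit_form g f = cnj (limit_form f g)"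
    proof (rule limit_form_eqI[OF v u])
      have "kernel_form K (v i) (u i) = cnj (kernel_form K (u i) (v i))" for i
        by (rule pre.sym) (rule mem)+
      then show "(\<lambda>i. kernel_form K (v i) (u i)) \<longlonglongrightarrow> cnj (limit_form f g)"
        using tendsto_cnj[OF limit_form_tendsto[OF u v]] by simp
    qed
    assume "h \<in> funs limit_space"
    then obtain w where w: "represents w h" by (auto simp: funs_limit_space)
    show "limit_form (f + g) h = limit_form f h + limit_form g h"
      by (rule limit_form_eqI[OF represents_add[OF u v] w])
        (use mem represents_mem[OF w] tendsto_add[OF limit_form_tendsto[OF u w] limit_form_tendsto[OF v w]]
          in \<open>simp add: pre.add_left\<close>)
  qed
  fix f assume "f \<in> funs limit_space"
  then obtain u where u: "represents u f" by (auto simp: funs_limit_space)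
  show "0 \<le> Re (form limit_space f f)"
    unfolding form_limit_space
    by (rule LIMSEQ_le_const[OF tendsto_Re[OF limit_form_tendsto[OF u u]]])
      (use pre.nonneg[OF represents_mem[OF u]] in auto)
qed

sublocale hil: semi_inner_space X "funs limit_space" "form limit_space"
  by (rule limit_space_semi_inner)

lemma nrm_tendsto:
  assumes "represents s f"
  shows "(\<lambda>i. pre.nrm (s i)) \<longlonglongrightarrow> hil.nrm f"
  unfolding seminorm_of_def form_limit_space
  by (intro tendsto_intros limit_form_tendsto assms)

lemma limit_form_definite:
  assumes "f \<in> funs limit_space" "f \<noteq> 0"
  shows "0 < Re (form limit_space f f)"
proof -
  obtain s where s: "represents s f" using assms by (auto simp: funs_limit_space)
  have "Re (form limit_space f f) \<noteq> 0"
  proof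
    assume "Re (form limit_space f f) = 0"
    then have null: "(\<lambda>i. pre.nrm (s i)) \<longlonglongrightarrow> 0"
      using nrm_tendsto[OF s] by (simp add: seminorm_of_def)
    have "f x = 0" for x
    proof (cases "x \<in> X")
      case True
      have "(\<lambda>i. kernel_form K (s i) (delta x)) \<longlonglongrightarrow> 0"
        by (rule pre.form_tendsto_zero[OF represents_mem[OF s] delta_mem[OF True] null order_refl])
      then show ?thesis
        using LIMSEQ_unique represents_tendsto[OF s True]
        by (simp add: kernel_form_delta[OF represents_mem[OF s] True])
    qed (rule represents_outside[OF s])
    then show False using assms(2) by auto
  qed
  then show ?thesis using hil.nonneg[OF assms(1)] by simp
qed

lemma limit_space_reproducing: "reproducing_on X K limit_space"
  unfolding reproducing_on_def
proof (intro ballI conjI)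
  fix y assume y: "y \<in> X"
  have k: "represents (\<lambda>i. delta y) (kernel_section X K y)"
    using represents_const[OF delta_mem[OF y]] by (simp add: kernel_comb_delta)
  then show "kernel_section X K y \<in> funs limit_space"
    by (auto simp: funs_limit_space)
  fix f assume "f \<in> funs limit_space"
  then obtain s where s: "represents s f" by (auto simp: funs_limit_space)
  show "f y = form limit_space f (kernel_section X K y)"
    unfolding form_limit_space
    by (rule limit_form_eqI[OF s k, symmetric])
      (use represents_tendsto[OF s y] in \<open>simp add: kernel_form_delta[OF represents_mem[OF s] y]\<close>)
qed

lemma comb_mem: "c \<in> finsupp_on X \<Longrightarrow> kernel_comb X K c \<in> funs limit_space"
  using represents_const by (auto simp: funs_limit_space)

text \<open>
  The distance of \<open>f\<close> to the \<open>i\<close>-th combination is the limit in \<open>j\<close> of the distance of \<open>s\<^sub>j\<close> to \<open>s\<^sub>i\<close>.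
\<close>

lemma represents_approx:
  assumes s: "represents s f"
  shows "(\<lambda>i. hil.nrm (f - kernel_comb X K (s i))) \<longlonglongrightarrow> 0"
proof (rule LIMSEQ_I)
  fix e :: real assume e: "0 < e"
  note mem = represents_mem[OF s]
  have f: "f \<in> funs limit_space" using s by (auto simp: funs_limit_space)
  obtain N where N: "\<forall>m\<ge>N. \<forall>n\<ge>N. pre.nrm (s m - s n) < e / 2"
    using pre.cauchy_seq_eventually[OF represents_cauchy[OF s], of "e / 2"] e by auto
  have "norm (hil.nrm (f - kernel_comb X K (s i)) - 0) < e" if i: "N \<le> i" for i
  proof -
    have "(\<lambda>j. pre.nrm (s j - s i)) \<longlonglongrightarrow> hil.nrm (f - kernel_comb X K (s i))"
      by (rule nrm_tendsto[OF represents_diff[OF s represents_const[OF mem]]])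
    then have "hil.nrm (f - kernel_comb X K (s i)) \<le> e / 2"
      by (rule LIMSEQ_le_const2) (use N i in \<open>auto intro: less_imp_le\<close>)
    then show ?thesis
      using e hil.nrm_nonneg[OF hil.diff_mem[OF f comb_mem[OF mem]]] by simp
  qed
  then show "\<exists>N. \<forall>i\<ge>N. norm (hil.nrm (f - kernel_comb X K (s i)) - 0) < e" by blast
qed

lemma comb_isometry:
  assumes W: "semi_inner_space X (funs W) (form W)" "reproducing_on X K W"
    and "c \<in> finsupp_on X" "d \<in> finsupp_on X"
  shows "seminorm_of (form W) (kernel_comb X K c - kernel_comb X K d) = pre.nrm (c - d)"
  unfolding kernel_comb_diff[OF assms(3,4), symmetric]
  by (simp add: seminorm_of_def reproducing_comb_comb[OF W] pre.diff_mem assms(3,4))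

text \<open>
  A Cauchy sequence in the limit space is approximated by kernel combinations, up to \<open>1 / (i + 1)\<close> in the
  \<open>i\<close>-th term. Their coefficients then form a Cauchy sequence, and the function that it represents is
  the limit.
\<close>

lemma limit_space_complete:
  assumes F: "hil.cauchy_seq F"
  shows "\<exists>f\<in>funs limit_space. (\<lambda>i. hil.nrm (F i - f)) \<longlonglongrightarrow> 0"
proof -
  note Fm = hil.cauchy_seq_mem[OF F]
  have "\<exists>c\<in>finsupp_on X. hil.nrm (F i - kernel_comb X K c) < 1 / (real i + 1)" for i
  proof -
    obtain s where s: "represents s (F i)" using Fm[of i] by (auto simp: funs_limit_space)
    have "0 < 1 / (real i + 1)" by simp
    from order_tendstoD(2)[OF represents_approx[OF s] this]
    obtain j where "hil.nrm (F i - kernel_comb X K (s j)) < 1 / (real i + 1)"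
      by (auto simp: eventually_sequentially)
    then show ?thesis using represents_mem[OF s] by blast
  qed
  then obtain v where v: "\<And>i. v i \<in> finsupp_on X"
    and close: "\<And>i. hil.nrm (F i - kernel_comb X K (v i)) < 1 / (real i + 1)"
    by metis
  let ?g = "\<lambda>i. kernel_comb X K (v i)"
  note gm = comb_mem[OF v]
  have null: "(\<lambda>i. 1 / (real i + 1)) \<longlonglongrightarrow> 0"
    using LIMSEQ_inverse_real_of_nat by (simp add: inverse_eq_divide add.commute)
  have "pre.cauchy_seq v"
    unfolding pre.cauchy_seq_def
  proof (intro conjI allI impI v)
    fix e :: real assume e: "0 < e"
    obtain N where N: "\<forall>m\<ge>N. \<forall>n\<ge>N. hil.nrm (F m - F n) < e / 3"
      using hil.cauchy_seq_eventually[OF F, of "e / 3"] e by auto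
    obtain M where M: "\<forall>i\<ge>M. 1 / (real i + 1) < e / 3"
      using order_tendstoD(2)[OF null, of "e / 3"] e by (auto simp: eventually_sequentially)
    have "pre.nrm (v m - v n) < e" if mn: "max M N \<le> m" "max M N \<le> n" for m n
    proof -
      have "hil.nrm (?g m - ?g n) = pre.nrm (v m - v n)"
        by (rule comb_isometry[OF limit_space_semi_inner limit_space_reproducing v v])
      moreover have "hil.nrm (?g m - ?g n) \<le> hil.nrm (?g m - F m) + hil.nrm (F m - ?g n)"
        by (rule hil.nrm_diff_triangle[OF gm Fm gm])
      moreover have "hil.nrm (?g m - F m) = hil.nrm (F m - ?g m)"
        by (rule hil.nrm_diff_commute[OF gm Fm])
      moreover have "hil.nrm (F m - ?g n) \<le> hil.nrm (F m - F n) + hil.nrm (F n - ?g n)"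
        by (rule hil.nrm_diff_triangle[OF Fm Fm gm])
      moreover have "hil.nrm (F m - ?g m) < e / 3" "hil.nrm (F n - ?g n) < e / 3"
        using close M mn by (meson less_trans max.boundedE)+
      moreover have "hil.nrm (F m - F n) < e / 3" using N mn by simp
      ultimately show ?thesis by linarith
    qed
    then show "\<exists>N. \<forall>m\<ge>N. \<forall>n\<ge>N. pre.nrm (v m - v n) < e" by blast
  qed
  then obtain f where f: "represents v f" by (rule cauchy_seq_represents)
  have fm: "f \<in> funs limit_space" using f by (auto simp: funs_limit_space)
  have bound: "norm (hil.nrm (F i - f)) \<le> 1 / (real i + 1) + hil.nrm (f - ?g i)" for i
    using hil.nrm_diff_triangle[OF Fm gm fm, of i i] hil.nrm_diff_commute[OF gm fm, of i] close[of i]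
      hil.nrm_nonneg[OF hil.diff_mem[OF Fm fm], of i] by simp
  have "(\<lambda>i. 1 / (real i + 1) + hil.nrm (f - ?g i)) \<longlonglongrightarrow> 0"
    using tendsto_add[OF null represents_approx[OF f]] by simp
  from Lim_null_comparison[OF always_eventually[OF allI[OF bound]] this]
  have "(\<lambda>i. hil.nrm (F i - f)) \<longlonglongrightarrow> 0" .
  then show ?thesis using fm by blast
qed

lemma limit_space_rkhs: "is_rkhs X K limit_space"
proof -
  have "hilbert_space_on X limit_space"
    unfolding hilbert_space_on_def
  proof (intro conjI allI impI ballI)
    fix s :: "nat \<Rightarrow> 'a \<Rightarrow> complex"
    assume "(\<forall>i. s i \<in> funs limit_space) \<and>
      (\<forall>e>0. \<exists>N. \<forall>m\<ge>N. \<forall>n\<ge>N. form_norm limit_space (s m - s n) < e)"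
    then have "hil.cauchy_seq s"
      by (simp add: hil.cauchy_seq_def form_norm_def seminorm_of_def)
    then show "\<exists>l\<in>funs limit_space. (\<lambda>i. form_norm limit_space (s i - l)) \<longlonglongrightarrow> 0"
      using limit_space_complete by (simp add: form_norm_def seminorm_of_def)
  qed (use hil.function_space hil.hermitian limit_form_definite in auto)
  moreover have "form limit_space f g = 0" if "f \<notin> funs limit_space \<or> g \<notin> funs limit_space" for f g
    using that by (auto simp: form_limit_space limit_form_def funs_limit_space)
  ultimately show ?thesis
    using limit_space_reproducing by (simp add: is_rkhs_def)
qed

text \<open>
  The functional on coefficient functions that \<open>f\<close> induces is, formally, the product of a kernel combination with \<open>f\<close>.
  The Cauchy sequence that represents it in the sense of \<open>riesz_sequence\<close> represents \<open>f\<close>, as one sees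
  by testing with \<open>delta\<close> functions.
\<close>

lemma mem_limit_spaceI:
  assumes outside: "\<And>x. x \<notin> X \<Longrightarrow> f x = 0"
    and bdd: "\<And>c. c \<in> finsupp_on X \<Longrightarrow> cmod (\<Sum>y | c y \<noteq> 0. c y * cnj (f y)) \<le> C * pre.nrm c"
  shows "f \<in> funs limit_space"
proof -
  define \<phi> where "\<phi> c = (\<Sum>y | c y \<noteq> 0. c y * cnj (f y))" for c
  have superset: "\<phi> c = (\<Sum>y\<in>A. c y * cnj (f y))" if "finite A" "{y. c y \<noteq> 0} \<subseteq> A" for c A
    unfolding \<phi>_def by (rule sum.mono_neutral_left) (use that in auto)
  have add: "\<phi> (c + d) = \<phi> c + \<phi> d" if cd: "c \<in> finsupp_on X" "d \<in> finsupp_on X" for c d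
  proof -
    let ?A = "{x. c x \<noteq> 0} \<union> {x. d x \<noteq> 0}"
    have A: "finite ?A" using cd by (auto simp: finsupp_on_def)
    show ?thesis
      by (subst (1 2 3) superset[OF A]) (auto simp: algebra_simps sum.distrib)
  qed
  have scale: "\<phi> (\<lambda>x. t * c x) = t * \<phi> c" if c: "c \<in> finsupp_on X" for c t
    by (subst (1 2) superset[OF finsupp_on_finite[OF c]]) (auto simp: algebra_simps sum_distrib_left)
  obtain s where s: "pre.cauchy_seq s"
    and lim: "\<And>v. v \<in> finsupp_on X \<Longrightarrow> (\<lambda>i. kernel_form K v (s i)) \<longlonglongrightarrow> \<phi> v"
    using pre.riesz_sequence[OF add scale bdd[folded \<phi>_def]] by blast
  have "(\<lambda>i. kernel_comb X K (s i) x) \<longlonglongrightarrow> f x" if x: "x \<in> X" for x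
  proof -
    note mem = pre.cauchy_seq_mem[OF s]
    have "(\<lambda>i. cnj (kernel_form K (delta x) (s i))) \<longlonglongrightarrow> cnj (\<phi> (delta x))"
      by (rule tendsto_cnj[OF lim[OF delta_mem[OF x]]])
    moreover have "cnj (kernel_form K (delta x) (s i)) = kernel_comb X K (s i) x" for i
      using pre.sym[OF delta_mem[OF x] mem] kernel_form_delta[OF mem x] by metis
    moreover have "cnj (\<phi> (delta x)) = f x"
      by (simp add: \<phi>_def delta_def)
    ultimately show ?thesis by simp
  qed
  then have "represents s f"
    using s outside by (simp add: represents_def)
  then show ?thesis by (auto simp: funs_limit_space)
qed

text \<open>
  The Cauchy-Schwarz inequality for \<open>f\<close> and a kernel combination gives the bound that
  \<open>mem_limit_spaceI\<close> asks for. It is stated for any space \<open>W\<close> in which \<open>K\<close>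
  reproduces, since uniqueness compares two such spaces.
\<close>

lemma reproducing_bound:
  assumes W: "semi_inner_space X (funs W) (form W)" and rep: "reproducing_on X K W"
    and f: "f \<in> funs W" and c: "c \<in> finsupp_on X"
  shows "cmod (\<Sum>y | c y \<noteq> 0. c y * cnj (f y)) \<le> seminorm_of (form W) f * pre.nrm c"
proof -
  interpret W: semi_inner_space X "funs W" "form W" by (rule W)
  have "(\<Sum>y | c y \<noteq> 0. c y * cnj (f y)) = cnj (form W f (kernel_comb X K c))"
    by (simp add: reproducing_comb[OF W rep c f])
  then have "cmod (\<Sum>y | c y \<noteq> 0. c y * cnj (f y)) = cmod (form W f (kernel_comb X K c))"
    by simp
  also have "\<dots> \<le> W.nrm f * W.nrm (kernel_comb X K c)"
    by (rule W.cauchy_schwarz[OF f reproducing_comb_mem[OF W rep c]])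
  also have "W.nrm (kernel_comb X K c) = pre.nrm c"
    by (simp add: seminorm_of_def reproducing_comb_comb[OF W rep c c])
  finally show ?thesis .
qed

text \<open>
  By the membership criterion \<open>W\<close> is contained in the limit space. Conversely, the kernel combinations
  along a Cauchy sequence of coefficients converge in \<open>W\<close>, and the limit is the function that the sequence
  represents, because evaluations are continuous on \<open>W\<close>. The forms agree since they agree on kernel
  combinations and both are continuous.
\<close>

lemma rkhs_unique:
  assumes "is_rkhs X K W"
  shows "W = limit_space"
proof -
  have hilW: "hilbert_space_on X W" and rep: "reproducing_on X K W"
    and out: "\<And>f g. f \<notin> funs W \<or> g \<notin> funs W \<Longrightarrow> form W f g = 0"
    using assms by (auto simp: is_rkhs_def)
  note W = hilbert_imp_semi_inner_space[OF hilW]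
  interpret W: semi_inner_space X "funs W" "form W" by (rule W)
  have complete: "\<exists>l\<in>funs W. (\<lambda>i. form_norm W (t i - l)) \<longlonglongrightarrow> 0"
    if "\<And>i. t i \<in> funs W" "\<forall>e>0. \<exists>N. \<forall>m\<ge>N. \<forall>n\<ge>N. form_norm W (t m - t n) < e"
    for t :: "nat \<Rightarrow> 'a \<Rightarrow> complex"
    using hilW that by (simp add: hilbert_space_on_def)
  have sub: "f \<in> funs limit_space" if "f \<in> funs W" for f
    by (rule mem_limit_spaceI[OF W.vanishes[OF that] reproducing_bound[OF W rep that]])
  have conv: "f \<in> funs W \<and> (\<lambda>i. W.nrm (kernel_comb X K (s i) - f)) \<longlonglongrightarrow> 0"
    if s: "represents s f" for s f
  proof -
    note mem = represents_mem[OF s]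
    note gm = reproducing_comb_mem[OF W rep mem]
    have "\<forall>e>0. \<exists>N. \<forall>m\<ge>N. \<forall>n\<ge>N.
        form_norm W (kernel_comb X K (s m) - kernel_comb X K (s n)) < e"
      using represents_cauchy[OF s] comb_isometry[OF W rep mem mem]
      by (simp add: form_norm_def seminorm_of_def pre.cauchy_seq_def)
    then obtain l where l: "l \<in> funs W" and lim: "(\<lambda>i. W.nrm (kernel_comb X K (s i) - l)) \<longlonglongrightarrow> 0"
      using complete[of "\<lambda>i. kernel_comb X K (s i)"] gm
      by (auto simp: form_norm_def seminorm_of_def)
    have "l x = f x" for x
    proof (cases "x \<in> X")
      case True
      have k: "kernel_section X K x \<in> funs W" and ev: "\<And>g. g \<in> funs W \<Longrightarrow> form W g (kernel_section X K x) = g x"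
        using rep True by (auto simp: reproducing_on_def)
      have "(\<lambda>i. form W (kernel_comb X K (s i)) (kernel_section X K x)) \<longlonglongrightarrow> form W l (kernel_section X K x)"
        by (rule W.form_tendsto[OF gm k l k lim])
          (use hermitian_form_on_zero[OF W.function_space W.hermitian W.zero_mem] in
            \<open>simp add: seminorm_of_def\<close>)
      then have "(\<lambda>i. kernel_comb X K (s i) x) \<longlonglongrightarrow> l x"
        using ev gm l by simp
      then show ?thesis using LIMSEQ_unique represents_tendsto[OF s True] by blast
    qed (simp add: W.vanishes[OF l] represents_outside[OF s])
    then have "l = f" by auto
    then show ?thesis using l lim by simp
  qed
  have funs_eq: "funs W = funs limit_space"
    using sub conv by (auto simp: funs_limit_space)
  have "form W f g = form limit_space f g" for f g
  proof (cases "f \<in> funs limit_space \<and> g \<in> funs limit_space")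
    case True
    then obtain s t where s: "represents s f" and t: "represents t g"
      by (auto simp: funs_limit_space)
    have "(\<lambda>i. form W (kernel_comb X K (s i)) (kernel_comb X K (t i))) \<longlonglongrightarrow> form W f g"
      by (rule W.form_tendsto[OF reproducing_comb_mem[OF W rep represents_mem[OF s]]
            reproducing_comb_mem[OF W rep represents_mem[OF t]]
            conjunct1[OF conv[OF s]] conjunct1[OF conv[OF t]]
            conjunct2[OF conv[OF s]] conjunct2[OF conv[OF t]]])
    then have "(\<lambda>i. kernel_form K (s i) (t i)) \<longlonglongrightarrow> form W f g"
      using reproducing_comb_comb[OF W rep represents_mem[OF s] represents_mem[OF t]] by simp
    then show ?thesis using limit_form_eqI[OF s t] by (simp add: form_limit_space)
  next
    case False
    then have "form W f g = 0" using out funs_eq by blast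
    moreover have "form limit_space f g = 0"
      using False limit_space_rkhs unfolding is_rkhs_def by blast
    ultimately show ?thesis by simp
  qed
  then show ?thesis using funs_eq by (intro form_space.equality) auto
qed

lemma rkhs_eq_limit_space: "rkhs X K = limit_space"
  unfolding rkhs_def by (rule the_equality) (rule limit_space_rkhs, rule rkhs_unique)

end

section \<open>The sum of two kernels\<close>

lemma kernel_form_sum:
  assumes "\<And>x y. x \<in> X \<Longrightarrow> y \<in> X \<Longrightarrow> K x y = K1 x y + K2 x y"
    and "c \<in> finsupp_on X" "d \<in> finsupp_on X"
  shows "kernel_form K c d = kernel_form K1 c d + kernel_form K2 c d"
  unfolding kernel_form_def sum.distrib[symmetric]
proof (intro sum.cong refl)
  fix y x assume "y \<in> {y. c y \<noteq> 0}" "x \<in> {x. d x \<noteq> 0}"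
  then have "K x y = K1 x y + K2 x y"
    using assms(1) finsupp_on_subset assms(2,3) by blast
  then show "c y * cnj (d x) * K x y = c y * cnj (d x) * K1 x y + c y * cnj (d x) * K2 x y"
    by (simp add: algebra_simps)
qed

text \<open>
  A Cauchy sequence for the seminorm of \<open>K\<close> is Cauchy for the smaller seminorms of \<open>K1\<close> and \<open>K2\<close>; it
  represents a function in each of the three spaces, and the first is the sum of the other two.
  Conversely, a functional bounded by the seminorm of \<open>K1\<close> or of \<open>K2\<close> is bounded by that of \<open>K\<close>.
\<close>

theorem funs_rkhs_sum:
  assumes K1: "psd_kernel_on X K1" and K2: "psd_kernel_on X K2"
    and K: "\<And>x y. x \<in> X \<Longrightarrow> y \<in> X \<Longrightarrow> K x y = K1 x y + K2 x y"
  shows "funs (rkhs X K) = {f + g | f g. f \<in> funs (rkhs X K1) \<and> g \<in> funs (rkhs X K2)}"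
proof -
  have split: "kernel_form K c d = kernel_form K1 c d + kernel_form K2 c d"
    if "c \<in> finsupp_on X" "d \<in> finsupp_on X" for c d
    by (rule kernel_form_sum[OF K that])
  have psd: "psd_kernel_on X K"
    unfolding psd_kernel_on_def
  proof (intro conjI ballI)
    fix x y assume xy: "x \<in> X" "y \<in> X"
    then have "K1 y x = cnj (K1 x y)" "K2 y x = cnj (K2 x y)"
      using K1 K2 unfolding psd_kernel_on_def by blast+
    then show "K y x = cnj (K x y)" unfolding K[OF xy] K[OF xy(2,1)] by simp
  next
    fix c assume c: "c \<in> finsupp_on X"
    then have "0 \<le> Re (kernel_form K1 c c)" "0 \<le> Re (kernel_form K2 c c)"
      using K1 K2 unfolding psd_kernel_on_def by blast+
    then show "0 \<le> Re (kernel_form K c c)" unfolding split[OF c c] by simp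
  qed
  interpret A: psd_kernel X K1 by unfold_locales (rule K1)
  interpret B: psd_kernel X K2 by unfold_locales (rule K2)
  interpret S: psd_kernel X K by unfold_locales (rule psd)
  have le: "A.pre.nrm c \<le> S.pre.nrm c" "B.pre.nrm c \<le> S.pre.nrm c" if "c \<in> finsupp_on X" for c
    using that by (auto simp: seminorm_of_def split A.pre.nonneg B.pre.nonneg)
  have "\<exists>g h. f = g + h \<and> g \<in> funs A.limit_space \<and> h \<in> funs B.limit_space"
    if f: "f \<in> funs S.limit_space" for f
  proof -
    obtain s where s: "S.represents s f" using f by (auto simp: S.funs_limit_space)
    note mem = S.represents_mem[OF s]
    have "A.pre.cauchy_seq s" "B.pre.cauchy_seq s"
      using S.represents_cauchy[OF s] mem
      unfolding A.pre.cauchy_seq_def B.pre.cauchy_seq_def S.pre.cauchy_seq_def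
      by (meson le S.pre.diff_mem order_le_less_trans)+
    then obtain g h where g: "A.represents s g" and h: "B.represents s h"
      using A.cauchy_seq_represents B.cauchy_seq_represents by metis
    have "f x = (g + h) x" for x
    proof (cases "x \<in> X")
      case True
      have "kernel_comb X K (s i) x = kernel_comb X K1 (s i) x + kernel_comb X K2 (s i) x" for i
        using split[OF mem delta_mem[OF True]]
        by (simp add: kernel_form_delta[OF mem True])
      then have "(\<lambda>i. kernel_comb X K (s i) x) \<longlonglongrightarrow> g x + h x"
        using tendsto_add[OF A.represents_tendsto[OF g True] B.represents_tendsto[OF h True]] by simp
      then show ?thesis using LIMSEQ_unique S.represents_tendsto[OF s True] by auto
    qed (simp add: S.represents_outside[OF s] A.represents_outside[OF g] B.represents_outside[OF h])
    then show ?thesis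
      using g h by (auto simp: A.funs_limit_space B.funs_limit_space fun_eq_iff)
  qed
  moreover have "f \<in> funs S.limit_space" if f: "f \<in> funs A.limit_space" for f
  proof (rule S.mem_limit_spaceI[OF A.hil.vanishes[OF f]])
    fix c assume c: "c \<in> finsupp_on X"
    show "cmod (\<Sum>y | c y \<noteq> 0. c y * cnj (f y)) \<le> A.hil.nrm f * S.pre.nrm c"
      using A.reproducing_bound[OF A.limit_space_semi_inner A.limit_space_reproducing f c]
        mult_left_mono[OF le(1)[OF c] A.hil.nrm_nonneg[OF f]] by (rule order_trans)
  qed
  moreover have "f \<in> funs S.limit_space" if f: "f \<in> funs B.limit_space" for f
  proof (rule S.mem_limit_spaceI[OF B.hil.vanishes[OF f]])
    fix c assume c: "c \<in> finsupp_on X"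
    show "cmod (\<Sum>y | c y \<noteq> 0. c y * cnj (f y)) \<le> B.hil.nrm f * S.pre.nrm c"
      using B.reproducing_bound[OF B.limit_space_semi_inner B.limit_space_reproducing f c]
        mult_left_mono[OF le(2)[OF c] B.hil.nrm_nonneg[OF f]] by (rule order_trans)
  qed
  ultimately show ?thesis
    unfolding A.rkhs_eq_limit_space B.rkhs_eq_limit_space S.rkhs_eq_limit_space
    using S.hil.add_mem by blast
qed

section \<open>Power series kernels\<close>

lemma psd_kernel_on_cong:
  assumes "psd_kernel_on X K" "\<And>x y. x \<in> X \<Longrightarrow> y \<in> X \<Longrightarrow> K' x y = K x y"
  shows "psd_kernel_on X K'"
proof -
  have "kernel_form K' c c = kernel_form K c c" if c: "c \<in> finsupp_on X" for c
    using kernel_form_sum[of X K' K "\<lambda>x y. 0", OF _ c c] assms(2)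
    by (simp add: kernel_form_def)
  then show ?thesis using assms unfolding psd_kernel_on_def by metis
qed

lemma star_prod_commute: "star_prod x y = cnj (star_prod y x)"
  by (simp add: star_prod_def mult.commute)

text \<open>
  This is a case of the Schur product theorem. One factor
  \<open>y\<^sup>* x = \<Sum>\<^sub>i cnj y\<^sub>i x\<^sub>i\<close> is expanded and absorbed into the coefficients, which turns the form for the exponent
  \<open>j + 1\<close> into a sum over \<open>i\<close> of the form for the exponent \<open>j\<close> at the coefficients \<open>c(y) cnj y\<^sub>i\<close>.
\<close>

lemma star_prod_power_psd:
  fixes A :: "(complex ^ 'n) set"
  shows "0 \<le> Re (\<Sum>y\<in>A. \<Sum>x\<in>A. c y * cnj (c x) * star_prod y x ^ j)"
proof (induction j arbitrary: c)
  case 0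
  have "(\<Sum>y\<in>A. \<Sum>x\<in>A. c y * cnj (c x)) = (\<Sum>y\<in>A. c y) * cnj (\<Sum>x\<in>A. c x)"
    by (simp add: sum_product)
  also have "\<dots> = of_real ((cmod (\<Sum>y\<in>A. c y))\<^sup>2)"
    by (simp only: complex_norm_square)
  finally have e: "(\<Sum>y\<in>A. \<Sum>x\<in>A. c y * cnj (c x)) = of_real ((cmod (\<Sum>y\<in>A. c y))\<^sup>2)" .
  show ?case unfolding power_0 mult_1_right e Re_complex_of_real by simp
next
  case (Suc j)
  define d where "d i y = c y * cnj (y $ i)" for i and y :: "complex ^ 'n"
  have "(\<Sum>y\<in>A. \<Sum>x\<in>A. c y * cnj (c x) * star_prod y x ^ Suc j)
      = (\<Sum>y\<in>A. \<Sum>x\<in>A. \<Sum>i\<in>UNIV. d i y * cnj (d i x) * star_prod y x ^ j)"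
  proof (intro sum.cong refl)
    fix y x
    have "c y * cnj (c x) * star_prod y x ^ Suc j
        = (\<Sum>i\<in>UNIV. cnj (y $ i) * x $ i) * (c y * cnj (c x) * star_prod y x ^ j)"
      by (simp add: star_prod_def)
    also have "\<dots> = (\<Sum>i\<in>UNIV. d i y * cnj (d i x) * star_prod y x ^ j)"
      unfolding sum_distrib_right by (rule sum.cong) (simp_all add: d_def mult_ac)
    finally show "c y * cnj (c x) * star_prod y x ^ Suc j
        = (\<Sum>i\<in>UNIV. d i y * cnj (d i x) * star_prod y x ^ j)" .
  qed
  also have "\<dots> = (\<Sum>y\<in>A. \<Sum>i\<in>UNIV. \<Sum>x\<in>A. d i y * cnj (d i x) * star_prod y x ^ j)"
    by (intro sum.cong refl sum.swap)
  also have "\<dots> = (\<Sum>i\<in>UNIV. \<Sum>y\<in>A. \<Sum>x\<in>A. d i y * cnj (d i x) * star_prod y x ^ j)"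
    by (rule sum.swap)
  finally have "Re (\<Sum>y\<in>A. \<Sum>x\<in>A. c y * cnj (c x) * star_prod y x ^ Suc j)
      = (\<Sum>i\<in>UNIV. Re (\<Sum>y\<in>A. \<Sum>x\<in>A. d i y * cnj (d i x) * star_prod y x ^ j))"
    by (simp only: Re_sum)
  also have "\<dots> \<ge> 0" by (intro sum_nonneg Suc.IH)
  finally show ?case .
qed

lemma series_kernel_sums:
  assumes "summable (\<lambda>j. \<bar>a j\<bar> * norm (star_prod y x) ^ j)" and "\<And>j. \<bar>b j\<bar> \<le> \<bar>a j\<bar>"
  shows "(\<lambda>j. complex_of_real (b j) * star_prod y x ^ j) sums series_kernel b x y"
  unfolding series_kernel_def
proof (intro summable_sums summable_comparison_test'[OF assms(1), of 0])
  fix j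
  show "norm (complex_of_real (b j) * star_prod y x ^ j) \<le> \<bar>a j\<bar> * norm (star_prod y x) ^ j"
    using mult_right_mono[OF assms(2)[of j], of "norm (star_prod y x) ^ j"]
    by (simp add: norm_mult norm_power)
qed

lemma series_kernel_psd:
  assumes nonneg: "\<And>j. 0 \<le> b j"
    and summ: "\<And>x y. x \<in> X \<Longrightarrow> y \<in> X \<Longrightarrow> summable (\<lambda>j. \<bar>b j\<bar> * norm (star_prod y x) ^ j)"
  shows "psd_kernel_on X (series_kernel b)"
  unfolding psd_kernel_on_def
proof (intro conjI ballI)
  note sums = series_kernel_sums[OF summ order_refl]
  fix x y assume xy: "x \<in> X" "y \<in> X"
  have "(\<lambda>j. cnj (complex_of_real (b j) * star_prod y x ^ j)) sums cnj (series_kernel b x y)"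
    using sums[OF xy] by (simp only: sums_cnj)
  then have "(\<lambda>j. complex_of_real (b j) * star_prod x y ^ j) sums cnj (series_kernel b x y)"
    by (simp add: star_prod_commute[of x y])
  then show "series_kernel b y x = cnj (series_kernel b x y)"
    by (rule sums_unique2[OF sums[OF xy(2,1)]])
next
  note sums = series_kernel_sums[OF summ order_refl]
  fix c assume c: "c \<in> finsupp_on X"
  let ?A = "{x. c x \<noteq> 0}"
  have "(\<lambda>j. \<Sum>y\<in>?A. \<Sum>x\<in>?A. c y * cnj (c x) * (complex_of_real (b j) * star_prod y x ^ j))
      sums kernel_form (series_kernel b) c c"
    unfolding kernel_form_def
    by (intro sums_sum sums_mult sums) (use finsupp_on_subset[OF c] in auto)
  moreover have "(\<Sum>y\<in>?A. \<Sum>x\<in>?A. c y * cnj (c x) * (complex_of_real (b j) * star_prod y x ^ j))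
      = complex_of_real (b j) * (\<Sum>y\<in>?A. \<Sum>x\<in>?A. c y * cnj (c x) * star_prod y x ^ j)" for j
    by (simp add: sum_distrib_left mult_ac)
  ultimately have "(\<lambda>j. Re (complex_of_real (b j)
        * (\<Sum>y\<in>?A. \<Sum>x\<in>?A. c y * cnj (c x) * star_prod y x ^ j)))
      sums Re (kernel_form (series_kernel b) c c)"
    by (intro sums_Re) simp
  then have s: "(\<lambda>j. b j * Re (\<Sum>y\<in>?A. \<Sum>x\<in>?A. c y * cnj (c x) * star_prod y x ^ j))
      sums Re (kernel_form (series_kernel b) c c)"
    by (simp only: Re_complex_of_real Im_complex_of_real times_complex.sel mult_zero_left diff_zero)
  show "0 \<le> Re (kernel_form (series_kernel b) c c)"
    by (rule sums_le[OF _ sums_zero s]) (intro mult_nonneg_nonneg nonneg star_prod_power_psd)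
qed

text \<open>
  The kernels \<open>K\<^sub>+\<close> and \<open>-K\<^sub>-\<close> have nonnegative coefficients, hence are positive semidefinite, and their
  sum is the series with coefficients \<open>\<bar>a\<^sub>j\<bar>\<close>, so the sum theorem applies.
\<close>

lemma funs_induced_krein_space:
  fixes X :: "(complex ^ 'n) set"
  assumes summ: "\<And>x y. x \<in> X \<Longrightarrow> y \<in> X \<Longrightarrow> summable (\<lambda>j. \<bar>a j\<bar> * norm (star_prod y x) ^ j)"
  shows "funs (induced_krein_space X a) = funs (rkhs X (series_kernel (\<lambda>j. \<bar>a j\<bar>)))"
proof -
  define p where "p j = (if a j > 0 then a j else 0)" for j
  define n where "n j = (if a j < 0 then a j else 0)" for j
  have sums: "(\<lambda>j. complex_of_real (b j) * star_prod y x ^ j) sums series_kernel b x y"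
    if "x \<in> X" "y \<in> X" "\<And>j. \<bar>b j\<bar> \<le> \<bar>a j\<bar>" for x y b
    using series_kernel_sums[OF summ] that by blast
  have psd: "psd_kernel_on X (series_kernel b)"
    if "\<And>j. 0 \<le> b j" "\<And>j. \<bar>b j\<bar> \<le> \<bar>a j\<bar>" for b
  proof (rule series_kernel_psd[OF that(1)])
    fix x y assume "x \<in> X" "y \<in> X"
    from summ[OF this] show "summable (\<lambda>j. \<bar>b j\<bar> * norm (star_prod y x) ^ j)"
      by (rule summable_comparison_test'[where N = 0]) (use that(2) in \<open>simp add: mult_right_mono\<close>)
  qed
  have neg: "- series_kernel n x y = series_kernel (\<lambda>j. - n j) x y" if "x \<in> X" "y \<in> X" for x y
    using sums_unique2[OF _ sums[OF that, of "\<lambda>j. - n j"], of "- series_kernel n x y"]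
      sums_minus[OF sums[OF that, of n]] by (simp add: n_def)
  have P: "psd_kernel_on X (series_kernel p)"
    by (rule psd) (auto simp: p_def)
  have "psd_kernel_on X (series_kernel (\<lambda>j. - n j))"
    by (rule psd) (auto simp: n_def)
  then have N: "psd_kernel_on X (\<lambda>x y. - series_kernel n x y)"
    by (rule psd_kernel_on_cong) (rule neg)
  have sum: "series_kernel (\<lambda>j. \<bar>a j\<bar>) x y = series_kernel p x y + - series_kernel n x y"
    if "x \<in> X" "y \<in> X" for x y
  proof (rule sums_unique2)
    show "(\<lambda>j. complex_of_real \<bar>a j\<bar> * star_prod y x ^ j) sums series_kernel (\<lambda>j. \<bar>a j\<bar>) x y"
      by (rule sums[OF that]) simp
    have "(\<lambda>j. complex_of_real (p j) * star_prod y x ^ j + - (complex_of_real (n j) * star_prod y x ^ j))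
        sums (series_kernel p x y + - series_kernel n x y)"
      by (intro sums_add sums_minus sums[OF that]) (auto simp: p_def n_def)
    moreover have "complex_of_real (p j) * star_prod y x ^ j + - (complex_of_real (n j) * star_prod y x ^ j)
        = complex_of_real \<bar>a j\<bar> * star_prod y x ^ j" for j
      by (auto simp: p_def n_def)
    ultimately show "(\<lambda>j. complex_of_real \<bar>a j\<bar> * star_prod y x ^ j)
        sums (series_kernel p x y + - series_kernel n x y)" by simp
  qed
  have "funs (induced_krein_space X a) =
      {f + g | f g. f \<in> funs (rkhs X (series_kernel p)) \<and> g \<in> funs (rkhs X (\<lambda>x y. - series_kernel n x y))}"
    by (simp add: induced_krein_space_def Let_def neg_form_def series_kernel_pos_def
        series_kernel_neg_def p_def[abs_def] n_def[abs_def])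
  also have "\<dots> = funs (rkhs X (series_kernel (\<lambda>j. \<bar>a j\<bar>)))"
    by (rule funs_rkhs_sum[OF P N sum, symmetric])
  finally show ?thesis .
qed

theorem theorem4p1p1:
  fixes a c :: "nat \<Rightarrow> real" and X :: "(complex ^ 'n) set"
  assumes "\<And>x y. x \<in> X \<Longrightarrow> y \<in> X \<Longrightarrow> summable (\<lambda>j. \<bar>a j\<bar> * norm (star_prod y x) ^ j)"
    and "\<And>j. c j \<in> {-1, 1}"
  shows "funs (induced_krein_space X (\<lambda>j. c j * a j)) = funs (induced_krein_space X a)"
proof -
  have abs: "\<bar>c j * a j\<bar> = \<bar>a j\<bar>" for j
    using assms(2)[of j] by auto
  have "funs (induced_krein_space X (\<lambda>j. c j * a j))
      = funs (rkhs X (series_kernel (\<lambda>j. \<bar>c j * a j\<bar>)))"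
    by (rule funs_induced_krein_space) (simp only: abs assms(1))
  also have "\<dots> = funs (induced_krein_space X a)"
    unfolding abs by (rule funs_induced_krein_space[OF assms(1), symmetric])
  finally show ?thesis .
qed

end
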